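(* Let $(\mathcal{O}X,\mathsf{u},\mathsf{d})$ be a conic frame, where $X$ is a locale. Then the localic relation $R_{\mathsf{u},\mathsf{d}}$ on $X$ is: (i) reflexive if and only if $\mathsf{u}$ and $\mathsf{d}$ are inflationary; (ii) transitive if and only if $\mathsf{u}$ and $\mathsf{d}$ are subidempotent; (iii) symmetric if and only if $\mathsf{u}=\mathsf{d}$.
   Context: Frames and locales. A frame is a complete lattice (order $\sqsubseteq$) in which $x\wedge\bigvee y_i=\bigvee (x\wedge y_i)$; frame maps preserve finite meets and all joins. The category of locales is the opposite of the category of frames: a locale $X$ has a frame of opens $\mathcal{O}X$, and a map $f\colon X\to Y$ is a frame map $f^{-1}\colon\mathcal{O}Y\to\mathcal{O}X$. $L\otimes M$ is the coproduct of frames, generated under joins by the rectangles $x\otimes y=\iota_1(x)\wedge\iota_2(y)$ ($\iota_1,\iota_2$ the coproduct injections); $\mathcal{O}(X\times Y)=\mathcal{O}X\otimes\mathcal{O}Y$. A sublocale of $X$ is (an isomorphism class of) an extremal monomorphism $A\rightarrowtail X$, equivalently a map whose frame map is surjective; $A\subseteq B$ means the inclusion of $A$ factors through that of $B$. Relations. A localic relation on $X$ is a sublocale $r\colon R\rightarrowtail X\times X$; its source and target maps are $s=\mathrm{pr}_1\circ r$, $t=\mathrm{pr}_2\circ r\colon R\to X$. $\Delta$ denotes the diagonal relation $X\rightarrowtail X\times X$; $R^{\mathrm{op}}$ is the relation with source and target interchanged; the composite $R\circ R$ is the image sublocale of the map $(s\circ\pi_1,t\circ\pi_2)\colon R\times_X^{t,s}R\to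 X\times X$, with $\pi_1,\pi_2$ the projections of the pullback of $t$ (first factor) and $s$ (second factor). $R$ is reflexive if $\Delta\subseteq R$, transitive if $R\circ R\subseteq R$, symmetric if $R=R^{\mathrm{op}}$. A function $c\colon L\to L$ is inflationary if $x\sqsubseteq c(x)$ for all $x$, and subidempotent if $c(c(x))\sqsubseteq c(x)$ for all $x$. Conic frames and induced relation. A conic frame $(L,\mathsf{u},\mathsf{d})$ is a frame $L$ with join-preserving functions $\mathsf{u},\mathsf{d}\colon L\to L$ that are parallel: $\mathsf{u}(x)\wedge y\sqsubseteq\mathsf{u}(x\wedge\mathsf{d}(y))$ and $x\wedge\mathsf{d}(y)\sqsubseteq\mathsf{d}(\mathsf{u}(x)\wedge y)$ for all $x,y\in L$. For a conic frame $(\mathcal{O}X,\mathsf{u},\mathsf{d})$, let $\sim$ be the binary relation on rectangles of $\mathcal{O}X\otimes\mathcal{O}X$ with $a\otimes b\sim c\otimes d$ iff $\mathsf{u}(a)\wedge b=\mathsf{u}(c)\wedge d$ and $a\wedge\mathsf{d}(b)=c\wedge\mathsf{d}(d)$. An element $o\in\mathcal{O}X\otimes\mathcal{O}X$ is $\sim$-saturated if for all $p\sim q$ and all $w$: $p\wedge w\sqsubseteq o$ iff $q\wedge w\sqsubseteq o$. $R_{\mathsf{u},\mathsf{d}}\rightarrowtail X\times X$ is the sublocale whose frame is the set of $\sim$-saturated elements, with frame map $\mu_\sim(o)=$ the least $\sim$-saturated element above $o$; equivalently, the quotient of $\mathcal{O}X\otimes\mathcal{O}X$ by the frame congruence generated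 by $\sim$. *)

theory Defs
  imports "HOL-Algebra.Complete_Lattice"
begin

section \<open>Frames and locales\<close>

locale frame = complete_lattice +
  assumes meet_sup_distrib:
    "\<lbrakk>x \<in> carrier L; A \<subseteq> carrier L\<rbrakk> \<Longrightarrow> x \<sqinter> \<Squnion>A = \<Squnion>((\<lambda>y. x \<sqinter> y) ` A)"

definition join_preserving ::
  "('a, 'c) gorder_scheme \<Rightarrow> ('b, 'd) gorder_scheme \<Rightarrow> ('a \<Rightarrow> 'b) \<Rightarrow> bool" where
  "join_preserving L M f \<longleftrightarrow>
     f \<in> carrier L \<rightarrow> carrier M \<and> (\<forall>A. A \<subseteq> carrier L \<longrightarrow> f (\<Squnion>\<^bsub>L\<^esub>A) = \<Squnion>\<^bsub>M\<^esub>(f ` A))"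

definition frame_map ::
  "('a, 'c) gorder_scheme \<Rightarrow> ('b, 'd) gorder_scheme \<Rightarrow> ('a \<Rightarrow> 'b) \<Rightarrow> bool" where
  "frame_map L M f \<longleftrightarrow>
     join_preserving L M f \<and> f \<top>\<^bsub>L\<^esub> = \<top>\<^bsub>M\<^esub> \<and>
     (\<forall>x\<in>carrier L. \<forall>y\<in>carrier L. f (x \<sqinter>\<^bsub>L\<^esub> y) = f x \<sqinter>\<^bsub>M\<^esub> f y)"

text \<open>
  A locale \<open>X\<close> is represented by its frame of opens, and a map of locales \<open>X \<rightarrow> Y\<close> by the frame map
  from the frame of \<open>Y\<close> to the frame of \<open>X\<close>.
\<close>

subsection \<open>Coproducts of frames (products of locales)\<close>

text \<open>
  The coproduct is constructed as the frame of those down-closed sets of pairs that are closed under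
  joins in each coordinate separately. The empty join is included, so that \<open>(\<bottom>, b)\<close> and \<open>(a, \<bottom>)\<close>
  belong to every element.
\<close>

definition C_ideals ::
  "('a, 'c) gorder_scheme \<Rightarrow> ('b, 'd) gorder_scheme \<Rightarrow> ('a \<times> 'b) set set" where
  "C_ideals L M = {U. U \<subseteq> carrier L \<times> carrier M \<and>
     (\<forall>a\<in>carrier L. \<forall>b\<in>carrier M. \<forall>(a', b')\<in>U. a \<sqsubseteq>\<^bsub>L\<^esub> a' \<and> b \<sqsubseteq>\<^bsub>M\<^esub> b' \<longrightarrow> (a, b) \<in> U) \<and>
     (\<forall>A b. A \<subseteq> carrier L \<and> b \<in> carrier M \<and> A \<times> {b} \<subseteq> U \<longrightarrow> (\<Squnion>\<^bsub>L\<^esub>A, b) \<in> U) \<and>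
     (\<forall>a B. a \<in> carrier L \<and> B \<subseteq> carrier M \<and> {a} \<times> B \<subseteq> U \<longrightarrow> (a, \<Squnion>\<^bsub>M\<^esub>B) \<in> U)}"

definition frame_coprod ::
  "('a, 'c) gorder_scheme \<Rightarrow> ('b, 'd) gorder_scheme \<Rightarrow> ('a \<times> 'b) set gorder" (infixr \<open>\<otimes>\<^sub>F\<close> 70) where
  "L \<otimes>\<^sub>F M = \<lparr>carrier = C_ideals L M, eq = (=), le = (\<subseteq>)\<rparr>"

definition inj1 ::
  "('a, 'c) gorder_scheme \<Rightarrow> ('b, 'd) gorder_scheme \<Rightarrow> 'a \<Rightarrow> ('a \<times> 'b) set" where
  "inj1 L M x = {(a, b) \<in> carrier L \<times> carrier M. a \<sqsubseteq>\<^bsub>L\<^esub> x \<or> b = \<bottom>\<^bsub>M\<^esub>}"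

definition inj2 ::
  "('a, 'c) gorder_scheme \<Rightarrow> ('b, 'd) gorder_scheme \<Rightarrow> 'b \<Rightarrow> ('a \<times> 'b) set" where
  "inj2 L M y = {(a, b) \<in> carrier L \<times> carrier M. a = \<bottom>\<^bsub>L\<^esub> \<or> b \<sqsubseteq>\<^bsub>M\<^esub> y}"

definition rect ::
  "('a, 'c) gorder_scheme \<Rightarrow> ('b, 'd) gorder_scheme \<Rightarrow> 'a \<Rightarrow> 'b \<Rightarrow> ('a \<times> 'b) set" where
  "rect L M x y = inj1 L M x \<sqinter>\<^bsub>L \<otimes>\<^sub>F M\<^esub> inj2 L M y"

text \<open>
  The frame map out of \<open>L \<otimes>\<^sub>F M\<close> induced by frame maps \<open>f\<close> and \<open>g\<close> into \<open>N\<close>, i.e. the pairing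
  \<open>(f, g)\<close> of the corresponding maps of locales.
\<close>

definition copair :: "('n, 'e) gorder_scheme \<Rightarrow> ('a \<Rightarrow> 'n) \<Rightarrow> ('b \<Rightarrow> 'n) \<Rightarrow> ('a \<times> 'b) set \<Rightarrow> 'n" where
  "copair N f g U = \<Squnion>\<^bsub>N\<^esub>((\<lambda>(a, b). f a \<sqinter>\<^bsub>N\<^esub> g b) ` U)"

subsection \<open>Quotients by generated frame congruences\<close>

definition saturated :: "('a, 'c) gorder_scheme \<Rightarrow> ('a \<times> 'a) set \<Rightarrow> 'a set" where
  "saturated M E = {x \<in> carrier M. \<forall>(p, q)\<in>E. \<forall>w\<in>carrier M.
     p \<sqinter>\<^bsub>M\<^esub> w \<sqsubseteq>\<^bsub>M\<^esub> x \<longleftrightarrow> q \<sqinter>\<^bsub>M\<^esub> w \<sqsubseteq>\<^bsub>M\<^esub> x}"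

definition quot_frame ::
  "('a, 'c) gorder_scheme \<Rightarrow> ('a \<times> 'a) set \<Rightarrow> ('a, 'c) gorder_scheme" where
  "quot_frame M E = M\<lparr>carrier := saturated M E\<rparr>"

definition quot_map :: "('a, 'c) gorder_scheme \<Rightarrow> ('a \<times> 'a) set \<Rightarrow> 'a \<Rightarrow> 'a" where
  "quot_map M E x = (THE m. least M m {y \<in> saturated M E. x \<sqsubseteq>\<^bsub>M\<^esub> y})"

subsection \<open>Sublocales\<close>

text \<open>
  A representative of a sublocale of \<open>X\<close> is a pair of a frame and a surjective frame map onto it
  from the frame of \<open>X\<close>.
\<close>

type_synonym ('a, 'r) subloc = "'r gorder \<times> ('a \<Rightarrow> 'r)"

definition is_sublocale :: "'a gorder \<Rightarrow> ('a, 'r) subloc \<Rightarrow> bool" where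
  "is_sublocale X A \<longleftrightarrow>
     frame (fst A) \<and> frame_map X (fst A) (snd A) \<and> snd A ` carrier X = carrier (fst A)"

definition subloc_le :: "'a gorder \<Rightarrow> ('a, 'r) subloc \<Rightarrow> ('a, 'q) subloc \<Rightarrow> bool" where
  "subloc_le X A B \<longleftrightarrow>
     (\<exists>k. frame_map (fst B) (fst A) k \<and> (\<forall>x\<in>carrier X. snd A x = k (snd B x)))"

text \<open>
  Equality of sublocales, i.e. isomorphism of representatives over \<open>X\<close>; the inverse of a bijective
  frame map is a frame map.
\<close>

definition subloc_eq :: "'a gorder \<Rightarrow> ('a, 'r) subloc \<Rightarrow> ('a, 'q) subloc \<Rightarrow> bool" where
  "subloc_eq X A B \<longleftrightarrow>
     (\<exists>k. frame_map (fst B) (fst A) k \<and> bij_betw k (carrier (fst B)) (carrier (fst A)) \<and>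
          (\<forall>x\<in>carrier X. snd A x = k (snd B x)))"

text \<open>
  The image of a map of locales \<open>Y \<rightarrow> X\<close> with frame map \<open>f\<close>: its frame is the range of \<open>f\<close>,
  a subframe of the frame of \<open>Y\<close>.
\<close>

definition image_subloc :: "'a gorder \<Rightarrow> 'b gorder \<Rightarrow> ('a \<Rightarrow> 'b) \<Rightarrow> ('a, 'b) subloc" where
  "image_subloc X Y f = (Y\<lparr>carrier := f ` carrier X\<rparr>, f)"

section \<open>Localic relations\<close>

type_synonym ('a, 'r) locrel = "(('a \<times> 'a) set, 'r) subloc"

definition localic_relation :: "'a gorder \<Rightarrow> ('a, 'r) locrel \<Rightarrow> bool" where
  "localic_relation X R \<longleftrightarrow> is_sublocale (X \<otimes>\<^sub>F X) R"

text \<open>The frame maps of the source and target maps of a relation.\<close>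

definition source :: "'a gorder \<Rightarrow> ('a, 'r) locrel \<Rightarrow> 'a \<Rightarrow> 'r" where
  "source X R = snd R \<circ> inj1 X X"

definition target :: "'a gorder \<Rightarrow> ('a, 'r) locrel \<Rightarrow> 'a \<Rightarrow> 'r" where
  "target X R = snd R \<circ> inj2 X X"

definition diagonal :: "'a gorder \<Rightarrow> ('a, 'a) locrel" where
  "diagonal X = (X, copair X id id)"

definition op_rel :: "'a gorder \<Rightarrow> ('a, 'r) locrel \<Rightarrow> ('a, 'r) locrel" where
  "op_rel X R = (fst R, copair (fst R) (target X R) (source X R))"

text \<open>
  The pullback of the target map (first factor) and the source map (second factor) is the pushout
  of their frame maps: the quotient of the coproduct identifying, for every open \<open>x\<close> of \<open>X\<close>, its
  preimages under the two composites to \<open>X\<close>.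
\<close>

definition glue :: "'a gorder \<Rightarrow> ('a, 'r) locrel \<Rightarrow> (('r \<times> 'r) set \<times> ('r \<times> 'r) set) set" where
  "glue X R = (\<lambda>x. (inj1 (fst R) (fst R) (target X R x), inj2 (fst R) (fst R) (source X R x))) ` carrier X"

definition pullback :: "'a gorder \<Rightarrow> ('a, 'r) locrel \<Rightarrow> ('r \<times> 'r) set gorder" where
  "pullback X R = quot_frame (fst R \<otimes>\<^sub>F fst R) (glue X R)"

definition proj1 :: "'a gorder \<Rightarrow> ('a, 'r) locrel \<Rightarrow> 'r \<Rightarrow> ('r \<times> 'r) set" where
  "proj1 X R = quot_map (fst R \<otimes>\<^sub>F fst R) (glue X R) \<circ> inj1 (fst R) (fst R)"

definition proj2 :: "'a gorder \<Rightarrow> ('a, 'r) locrel \<Rightarrow> 'r \<Rightarrow> ('r \<times> 'r) set" where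
  "proj2 X R = quot_map (fst R \<otimes>\<^sub>F fst R) (glue X R) \<circ> inj2 (fst R) (fst R)"

definition self_comp :: "'a gorder \<Rightarrow> ('a, 'r) locrel \<Rightarrow> ('a, ('r \<times> 'r) set) locrel" where
  "self_comp X R = image_subloc (X \<otimes>\<^sub>F X) (pullback X R)
     (copair (pullback X R) (proj1 X R \<circ> source X R) (proj2 X R \<circ> target X R))"

definition reflexive_rel :: "'a gorder \<Rightarrow> ('a, 'r) locrel \<Rightarrow> bool" where
  "reflexive_rel X R \<longleftrightarrow> subloc_le (X \<otimes>\<^sub>F X) (diagonal X) R"

definition transitive_rel :: "'a gorder \<Rightarrow> ('a, 'r) locrel \<Rightarrow> bool" where
  "transitive_rel X R \<longleftrightarrow> subloc_le (X \<otimes>\<^sub>F X) (self_comp X R) R"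

definition symmetric_rel :: "'a gorder \<Rightarrow> ('a, 'r) locrel \<Rightarrow> bool" where
  "symmetric_rel X R \<longleftrightarrow> subloc_eq (X \<otimes>\<^sub>F X) R (op_rel X R)"

section \<open>Conic frames\<close>

locale conic_frame = frame +
  fixes u d :: "'a \<Rightarrow> 'a"
  assumes join_preserving_u: "join_preserving L L u"
    and join_preserving_d: "join_preserving L L d"
    and parallel_u: "\<lbrakk>x \<in> carrier L; y \<in> carrier L\<rbrakk> \<Longrightarrow> u x \<sqinter> y \<sqsubseteq> u (x \<sqinter> d y)"
    and parallel_d: "\<lbrakk>x \<in> carrier L; y \<in> carrier L\<rbrakk> \<Longrightarrow> x \<sqinter> d y \<sqsubseteq> d (u x \<sqinter> y)"

definition inflationary :: "('a, 'c) gorder_scheme \<Rightarrow> ('a \<Rightarrow> 'a) \<Rightarrow> bool" where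
  "inflationary L c \<longleftrightarrow> (\<forall>x\<in>carrier L. x \<sqsubseteq>\<^bsub>L\<^esub> c x)"

definition subidempotent :: "('a, 'c) gorder_scheme \<Rightarrow> ('a \<Rightarrow> 'a) \<Rightarrow> bool" where
  "subidempotent L c \<longleftrightarrow> (\<forall>x\<in>carrier L. c (c x) \<sqsubseteq>\<^bsub>L\<^esub> c x)"

definition conic_sim :: "'a gorder \<Rightarrow> ('a \<Rightarrow> 'a) \<Rightarrow> ('a \<Rightarrow> 'a) \<Rightarrow> (('a \<times> 'a) set \<times> ('a \<times> 'a) set) set" where
  "conic_sim X u d = {(rect X X a b, rect X X a' b') | a b a' b'.
     a \<in> carrier X \<and> b \<in> carrier X \<and> a' \<in> carrier X \<and> b' \<in> carrier X \<and>
     u a \<sqinter>\<^bsub>X\<^esub> b = u a' \<sqinter>\<^bsub>X\<^esub> b' \<and> a \<sqinter>\<^bsub>X\<^esub> d b = a' \<sqinter>\<^bsub>X\<^esub> d b'}"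

definition conic_rel :: "'a gorder \<Rightarrow> ('a \<Rightarrow> 'a) \<Rightarrow> ('a \<Rightarrow> 'a) \<Rightarrow> ('a, ('a \<times> 'a) set) locrel" where
  "conic_rel X u d =
     (quot_frame (X \<otimes>\<^sub>F X) (conic_sim X u d), quot_map (X \<otimes>\<^sub>F X) (conic_sim X u d))"

section \<open>Adequacy of the constructions\<close>

text \<open>
  \<open>L \<otimes>\<^sub>F M\<close> is a frame and a coproduct, joins of rectangles generate it, \<open>quot_map\<close> is the
  quotient by the frame congruence generated by a relation, and \<open>conic_rel\<close> is a localic relation.
\<close>

subsection \<open>The coproduct and its universal property\<close>

lemma (in complete_lattice) top_eqI: "\<lbrakk>t \<in> carrier L; \<And>x. x \<in> carrier L \<Longrightarrow> x \<sqsubseteq> t\<rbrakk> \<Longrightarrow> t = \<top>"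
  using top_weak_eq eq_is_equal by simp

context frame begin

lemma le_meet_iff: "\<lbrakk>z \<in> carrier L; x \<in> carrier L; y \<in> carrier L\<rbrakk> \<Longrightarrow> z \<sqsubseteq> x \<sqinter> y \<longleftrightarrow> z \<sqsubseteq> x \<and> z \<sqsubseteq> y"
  using le_trans[OF _ meet_left[of x y], of z] le_trans[OF _ meet_right[of x y], of z] meet_le by auto

lemma bottom_le: "\<lbrakk>z \<in> carrier L; z \<sqsubseteq> \<bottom>\<rbrakk> \<Longrightarrow> z = \<bottom>"
  by (rule le_antisym) auto

lemma sup_eqI: "\<lbrakk>A \<subseteq> carrier L; s \<in> carrier L; \<And>x. x \<in> A \<Longrightarrow> x \<sqsubseteq> s; 
   \<And>z. \<lbrakk>z \<in> carrier L; \<And>x. x \<in> A \<Longrightarrow> x \<sqsubseteq> z\<rbrakk> \<Longrightarrow> s \<sqsubseteq> z\<rbrakk> \<Longrightarrow> \<Squnion>A = s"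
  by (rule le_antisym) (simp_all add: sup_least sup_upper)

lemma meet_eqI: "\<lbrakk>x \<in> carrier L; y \<in> carrier L; s \<in> carrier L; s \<sqsubseteq> x; s \<sqsubseteq> y; 
   \<And>z. \<lbrakk>z \<in> carrier L; z \<sqsubseteq> x; z \<sqsubseteq> y\<rbrakk> \<Longrightarrow> s = z \<or> z \<sqsubseteq> s\<rbrakk> \<Longrightarrow> x \<sqinter> y = s"
  by (metis le_antisym meet_closed meet_le meet_left meet_right)

lemma meet_mono:
  assumes "x \<in> carrier L" "y \<in> carrier L" "x' \<in> carrier L" "y' \<in> carrier L" "x \<sqsubseteq> x'" "y \<sqsubseteq> y'"
  shows "x \<sqinter> y \<sqsubseteq> x' \<sqinter> y'"
  by (meson assms le_trans meet_closed meet_le meet_left meet_right)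

lemma sup_meet_distrib:
  "\<lbrakk>x \<in> carrier L; A \<subseteq> carrier L\<rbrakk> \<Longrightarrow> \<Squnion>A \<sqinter> x = \<Squnion>((\<lambda>y. y \<sqinter> x) ` A)"
  using meet_sup_distrib by (simp add: meet_comm)

lemma sup_empty_eq: "\<Squnion>{} = \<bottom>" using weak_sup_empty eq_is_equal by simp
end

lemma coprod_partial_order: "partial_order (L \<otimes>\<^sub>F M)"
  by unfold_locales (auto simp: frame_coprod_def)

lemma carrier_coprod[simp]: "carrier (L \<otimes>\<^sub>F M) = C_ideals L M"
  and le_coprod[simp]: "(\<sqsubseteq>\<^bsub>L \<otimes>\<^sub>F M\<^esub>) = (\<subseteq>)"
  by (auto simp: frame_coprod_def)

lemma C_idealI:
  assumes "U \<subseteq> carrier L \<times> carrier M"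
   "\<And>a b a' b'. \<lbrakk>a \<in> carrier L; b \<in> carrier M; (a', b') \<in> U; a \<sqsubseteq>\<^bsub>L\<^esub> a'; b \<sqsubseteq>\<^bsub>M\<^esub> b'\<rbrakk> \<Longrightarrow> (a, b) \<in> U"
   "\<And>A b. \<lbrakk>A \<subseteq> carrier L; b \<in> carrier M; \<And>a. a \<in> A \<Longrightarrow> (a,b) \<in> U\<rbrakk> \<Longrightarrow> (\<Squnion>\<^bsub>L\<^esub>A, b) \<in> U"
   "\<And>a B. \<lbrakk>a \<in> carrier L; B \<subseteq> carrier M; \<And>b. b \<in> B \<Longrightarrow> (a,b) \<in> U\<rbrakk> \<Longrightarrow> (a, \<Squnion>\<^bsub>M\<^esub>B) \<in> U"
  shows "U \<in> C_ideals L M"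
  unfolding C_ideals_def mem_Collect_eq
proof (intro conjI allI impI ballI)
  show "U \<subseteq> carrier L \<times> carrier M" by (rule assms(1))
next
  fix a b p assume "a \<in> carrier L" "b \<in> carrier M" "p \<in> U"
  then show "case p of (a', b') \<Rightarrow> a \<sqsubseteq>\<^bsub>L\<^esub> a' \<and> b \<sqsubseteq>\<^bsub>M\<^esub> b' \<longrightarrow> (a, b) \<in> U"
    using assms(2) by (cases p) simp
next
  fix A b assume "A \<subseteq> carrier L \<and> b \<in> carrier M \<and> A \<times> {b} \<subseteq> U"
  then show "(\<Squnion>\<^bsub>L\<^esub>A, b) \<in> U" by (intro assms(3)) auto
next
  fix a B assume "a \<in> carrier L \<and> B \<subseteq> carrier M \<and> {a} \<times> B \<subseteq> U"
  then show "(a, \<Squnion>\<^bsub>M\<^esub>B) \<in> U" by (intro assms(4)) auto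
qed

lemma C_idealD:
  assumes "U \<in> C_ideals L M"
  shows "U \<subseteq> carrier L \<times> carrier M"
   "\<lbrakk>a \<in> carrier L; b \<in> carrier M; (a', b') \<in> U; a \<sqsubseteq>\<^bsub>L\<^esub> a'; b \<sqsubseteq>\<^bsub>M\<^esub> b'\<rbrakk> \<Longrightarrow> (a, b) \<in> U"
   "\<lbrakk>A \<subseteq> carrier L; b \<in> carrier M; \<And>a. a \<in> A \<Longrightarrow> (a,b) \<in> U\<rbrakk> \<Longrightarrow> (\<Squnion>\<^bsub>L\<^esub>A, b) \<in> U"
   "\<lbrakk>a \<in> carrier L; B \<subseteq> carrier M; \<And>b. b \<in> B \<Longrightarrow> (a,b) \<in> U\<rbrakk> \<Longrightarrow> (a, \<Squnion>\<^bsub>M\<^esub>B) \<in> U"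
proof -
  note U = assms[unfolded C_ideals_def mem_Collect_eq]
  show "U \<subseteq> carrier L \<times> carrier M" using U by (elim conjE)
  show "(a, b) \<in> U" if "a \<in> carrier L" "b \<in> carrier M" "(a', b') \<in> U" "a \<sqsubseteq>\<^bsub>L\<^esub> a'" "b \<sqsubseteq>\<^bsub>M\<^esub> b'"
    using U that by fast
  have 3: "\<forall>A b. A \<subseteq> carrier L \<and> b \<in> carrier M \<and> A \<times> {b} \<subseteq> U \<longrightarrow> (\<Squnion>\<^bsub>L\<^esub>A, b) \<in> U"
    using U by (elim conjE)
  show "(\<Squnion>\<^bsub>L\<^esub>A, b) \<in> U" if "A \<subseteq> carrier L" "b \<in> carrier M" "\<And>a. a \<in> A \<Longrightarrow> (a,b) \<in> U"
    by (rule 3[rule_format]) (use that in auto)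
  have 4: "\<forall>a B. a \<in> carrier L \<and> B \<subseteq> carrier M \<and> {a} \<times> B \<subseteq> U \<longrightarrow> (a, \<Squnion>\<^bsub>M\<^esub>B) \<in> U"
    using U by (elim conjE)
  show "(a, \<Squnion>\<^bsub>M\<^esub>B) \<in> U" if "a \<in> carrier L" "B \<subseteq> carrier M" "\<And>b. b \<in> B \<Longrightarrow> (a,b) \<in> U"
    by (rule 4[rule_format]) (use that in auto)
qed

lemma C_ideals_Inter:
  assumes "\<And>U. U \<in> S \<Longrightarrow> U \<in> C_ideals L M" "S \<noteq> {}"
  shows "\<Inter>S \<in> C_ideals L M"
proof (rule C_idealI)
  show "\<Inter>S \<subseteq> carrier L \<times> carrier M" using assms C_idealD(1) by blast
next
  show "(\<Squnion>\<^bsub>L\<^esub>A, b) \<in> \<Inter>S" if "A \<subseteq> carrier L" "b \<in> carrier M" "\<And>a. a \<in> A \<Longrightarrow> (a,b) \<in> \<Inter>S" for A b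
    using that by (auto intro!: C_idealD(3)[OF assms(1)])
  show "(a, \<Squnion>\<^bsub>M\<^esub>B) \<in> \<Inter>S" if "a \<in> carrier L" "B \<subseteq> carrier M" "\<And>b. b \<in> B \<Longrightarrow> (a,b) \<in> \<Inter>S" for a B
    using that by (auto intro!: C_idealD(4)[OF assms(1)])
qed (use assms in \<open>auto intro: C_idealD(2)\<close>)

locale two_frames = L: frame L + M: frame M for L :: "('a,'c) gorder_scheme" and M :: "('b,'d) gorder_scheme"
begin

lemma full: "carrier L \<times> carrier M \<in> C_ideals L M"
  by (rule C_idealI) auto

lemma coprod_complete: "complete_lattice (L \<otimes>\<^sub>F M)"
proof -
  interpret P: partial_order "L \<otimes>\<^sub>F M" by (rule coprod_partial_order)
  show ?thesis
  proof (rule P.complete_lattice_criterion1)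
    show "\<exists>g. greatest (L \<otimes>\<^sub>F M) g (carrier (L \<otimes>\<^sub>F M))"
      by (rule exI[of _ "carrier L \<times> carrier M"]) (auto simp: greatest_def full dest: C_idealD(1))
    fix A assume "A \<subseteq> carrier (L \<otimes>\<^sub>F M)" "A \<noteq> {}"
    then show "\<exists>i. greatest (L \<otimes>\<^sub>F M) i (Lower (L \<otimes>\<^sub>F M) A)"
      by (intro exI[of _ "\<Inter>A"]) (auto simp: greatest_def Lower_def intro!: C_ideals_Inter)
  qed
qed

sublocale P: complete_lattice "L \<otimes>\<^sub>F M" by (rule coprod_complete)

lemma Int_C: "\<lbrakk>U \<in> C_ideals L M; V \<in> C_ideals L M\<rbrakk> \<Longrightarrow> U \<inter> V \<in> C_ideals L M"
  using C_ideals_Inter[of "{U,V}"] by auto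

lemma coprod_meet: 
  assumes "U \<in> C_ideals L M" "V \<in> C_ideals L M" shows "U \<sqinter>\<^bsub>L \<otimes>\<^sub>F M\<^esub> V = U \<inter> V"
proof (rule P.le_antisym)
  show "U \<sqinter>\<^bsub>L \<otimes>\<^sub>F M\<^esub> V \<sqsubseteq>\<^bsub>L \<otimes>\<^sub>F M\<^esub> U \<inter> V" 
    using P.meet_left[of U V] P.meet_right[of U V] assms by auto
  show "U \<inter> V \<sqsubseteq>\<^bsub>L \<otimes>\<^sub>F M\<^esub> U \<sqinter>\<^bsub>L \<otimes>\<^sub>F M\<^esub> V" 
    using P.meet_le[of "U \<inter> V" U V] assms by (auto simp: Int_C)
qed (use assms P.meet_closed[of U V] in \<open>auto simp: Int_C\<close>)

lemma imp_C:
  assumes T: "T \<in> C_ideals L M" and A: "A \<subseteq> carrier L \<times> carrier M"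
  shows "{(a,b) \<in> carrier L \<times> carrier M. \<forall>(c,e)\<in>A. (a \<sqinter>\<^bsub>L\<^esub> c, b \<sqinter>\<^bsub>M\<^esub> e) \<in> T} \<in> C_ideals L M" (is "?W \<in> _")
proof (rule C_idealI)
  show "?W \<subseteq> carrier L \<times> carrier M" by auto
next
  fix a b a' b' assume h: "a \<in> carrier L" "b \<in> carrier M" "(a', b') \<in> ?W" "a \<sqsubseteq>\<^bsub>L\<^esub> a'" "b \<sqsubseteq>\<^bsub>M\<^esub> b'"
  have "(a \<sqinter>\<^bsub>L\<^esub> c, b \<sqinter>\<^bsub>M\<^esub> e) \<in> T" if "(c,e) \<in> A" for c e
  proof (rule C_idealD(2)[OF T, of _ _ "a' \<sqinter>\<^bsub>L\<^esub> c" "b' \<sqinter>\<^bsub>M\<^esub> e"])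
    show "(a' \<sqinter>\<^bsub>L\<^esub> c, b' \<sqinter>\<^bsub>M\<^esub> e) \<in> T" using h that by auto
  qed (use h that A in \<open>auto intro!: L.meet_mono M.meet_mono\<close>)
  then show "(a,b) \<in> ?W" using h by auto
next
  fix P b assume h: "P \<subseteq> carrier L" "b \<in> carrier M" "\<And>a. a \<in> P \<Longrightarrow> (a,b) \<in> ?W"
  have "(\<Squnion>\<^bsub>L\<^esub>P \<sqinter>\<^bsub>L\<^esub> c, b \<sqinter>\<^bsub>M\<^esub> e) \<in> T" if "(c,e) \<in> A" for c e
  proof -
    have c: "c \<in> carrier L" "e \<in> carrier M" using that A by auto
    show ?thesis unfolding L.sup_meet_distrib[OF c(1) h(1)]
      by (rule C_idealD(3)[OF T]) (use h(1) h(2) c in \<open>auto dest!: h(3) simp: that split: prod.splits dest!: bspec[OF _ that]\<close>)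
  qed
  then show "(\<Squnion>\<^bsub>L\<^esub>P, b) \<in> ?W" using h by auto
next
  fix a P assume h: "a \<in> carrier L" "P \<subseteq> carrier M" "\<And>b. b \<in> P \<Longrightarrow> (a,b) \<in> ?W"
  have "(a \<sqinter>\<^bsub>L\<^esub> c, \<Squnion>\<^bsub>M\<^esub>P \<sqinter>\<^bsub>M\<^esub> e) \<in> T" if "(c,e) \<in> A" for c e
  proof -
    have c: "c \<in> carrier L" "e \<in> carrier M" using that A by auto
    show ?thesis unfolding M.sup_meet_distrib[OF c(2) h(2)]
      by (rule C_idealD(4)[OF T]) (use h(1) h(2) c in \<open>auto dest!: h(3) simp: that split: prod.splits dest!: bspec[OF _ that]\<close>)
  qed
  then show "(a, \<Squnion>\<^bsub>M\<^esub>P) \<in> ?W" using h by auto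
qed

lemma coprod_frame: "frame (L \<otimes>\<^sub>F M)"
proof unfold_locales
  fix A S assume A: "A \<in> carrier (L \<otimes>\<^sub>F M)" and S: "S \<subseteq> carrier (L \<otimes>\<^sub>F M)"
  let ?T = "\<Squnion>\<^bsub>L \<otimes>\<^sub>F M\<^esub>((\<lambda>y. A \<sqinter>\<^bsub>L \<otimes>\<^sub>F M\<^esub> y) ` S)"
  have im: "(\<lambda>y. A \<sqinter>\<^bsub>L \<otimes>\<^sub>F M\<^esub> y) ` S \<subseteq> carrier (L \<otimes>\<^sub>F M)" using A S P.meet_closed by blast
  have T: "?T \<in> C_ideals L M" using P.sup_closed[OF im] by simp
  have SS: "\<Squnion>\<^bsub>L \<otimes>\<^sub>F M\<^esub>S \<in> C_ideals L M" using P.sup_closed[OF S] by simp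
  let ?W = "{(a,b) \<in> carrier L \<times> carrier M. \<forall>(c,e)\<in>A. (a \<sqinter>\<^bsub>L\<^esub> c, b \<sqinter>\<^bsub>M\<^esub> e) \<in> ?T}"
  have Ac: "A \<subseteq> carrier L \<times> carrier M" using A C_idealD(1)[of A L M] by auto
  have W: "?W \<in> C_ideals L M" by (rule imp_C[OF T Ac])
  have "s \<subseteq> ?W" if s: "s \<in> S" for s
  proof -
    have sc: "s \<in> C_ideals L M" using s S by auto
    have 1: "A \<inter> s \<subseteq> ?T" using P.sup_upper[OF im, of "A \<sqinter>\<^bsub>L \<otimes>\<^sub>F M\<^esub> s"] s A sc by (auto simp: coprod_meet)
    have "(a \<sqinter>\<^bsub>L\<^esub> c, b \<sqinter>\<^bsub>M\<^esub> e) \<in> A \<inter> s" if "(a,b) \<in> s" "(c,e) \<in> A" for a b c e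
    proof -
      have c: "a \<in> carrier L" "c \<in> carrier L" "b \<in> carrier M" "e \<in> carrier M"
        using that C_idealD(1)[OF sc] Ac by auto
      show ?thesis using A C_idealD(2)[OF sc _ _ that(1)] C_idealD(2)[of A L M _ _ c e, OF _ _ _ that(2)] c 
        by (auto simp: L.meet_left L.meet_right M.meet_left M.meet_right)
    qed
    then show ?thesis using 1 C_idealD(1)[OF sc] by blast
  qed
  then have "\<Squnion>\<^bsub>L \<otimes>\<^sub>F M\<^esub>S \<subseteq> ?W" using P.sup_least[OF S, of ?W] W by auto
  then have "A \<inter> \<Squnion>\<^bsub>L \<otimes>\<^sub>F M\<^esub>S \<subseteq> ?T"
  proof (intro subsetI)
    fix p assume h: "\<Squnion>\<^bsub>L \<otimes>\<^sub>F M\<^esub>S \<subseteq> ?W" "p \<in> A \<inter> \<Squnion>\<^bsub>L \<otimes>\<^sub>F M\<^esub>S"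
    obtain a b where p: "p = (a,b)" by (cases p)
    with h have "(a \<sqinter>\<^bsub>L\<^esub> a, b \<sqinter>\<^bsub>M\<^esub> b) \<in> ?T" "a \<in> carrier L" "b \<in> carrier M" by auto
    moreover have "a \<sqinter>\<^bsub>L\<^esub> a = a" "b \<sqinter>\<^bsub>M\<^esub> b = b" using calculation
      by (auto intro: L.meet_eqI M.meet_eqI)
    ultimately show "p \<in> ?T" using p by simp
  qed
  moreover have "?T \<subseteq> A \<inter> \<Squnion>\<^bsub>L \<otimes>\<^sub>F M\<^esub>S"
  proof -
    have "x \<sqsubseteq>\<^bsub>L \<otimes>\<^sub>F M\<^esub> A \<inter> \<Squnion>\<^bsub>L \<otimes>\<^sub>F M\<^esub>S" if "x \<in> (\<lambda>y. A \<sqinter>\<^bsub>L \<otimes>\<^sub>F M\<^esub> y) ` S" for x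
    proof -
      from that obtain s where s: "s \<in> S" "x = A \<sqinter>\<^bsub>L \<otimes>\<^sub>F M\<^esub> s" by auto
      then have "x = A \<inter> s" using A S by (auto simp: coprod_meet subset_iff)
      then show ?thesis using P.sup_upper[OF S s(1)] by auto
    qed
    from P.sup_least[OF im _ this] show ?thesis using A SS by (auto simp: Int_C)
  qed
  ultimately show "A \<sqinter>\<^bsub>L \<otimes>\<^sub>F M\<^esub> \<Squnion>\<^bsub>L \<otimes>\<^sub>F M\<^esub>S = ?T"
    using A SS by (auto simp: coprod_meet)
qed

sublocale P: frame "L \<otimes>\<^sub>F M" by (rule coprod_frame)

lemma bot_L: "U \<in> C_ideals L M \<Longrightarrow> b \<in> carrier M \<Longrightarrow> (\<bottom>\<^bsub>L\<^esub>, b) \<in> U"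
  using C_idealD(3)[of U L M "{}" b] L.sup_empty_eq by auto
lemma bot_R: "U \<in> C_ideals L M \<Longrightarrow> a \<in> carrier L \<Longrightarrow> (a, \<bottom>\<^bsub>M\<^esub>) \<in> U"
  using C_idealD(4)[of U L M a "{}"] M.sup_empty_eq by auto

lemma inj1_C: assumes x: "x \<in> carrier L" shows "inj1 L M x \<in> C_ideals L M"
proof (rule C_idealI)
  fix a b a' b' assume "a \<in> carrier L" "b \<in> carrier M" "(a', b') \<in> inj1 L M x" "a \<sqsubseteq>\<^bsub>L\<^esub> a'" "b \<sqsubseteq>\<^bsub>M\<^esub> b'"
  then show "(a, b) \<in> inj1 L M x" unfolding inj1_def
    using x M.bottom_le[of b] L.le_trans[of a a' x] by auto
next
  fix A b assume "A \<subseteq> carrier L" "b \<in> carrier M" "\<And>a. a \<in> A \<Longrightarrow> (a,b) \<in> inj1 L M x"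
  then show "(\<Squnion>\<^bsub>L\<^esub>A, b) \<in> inj1 L M x" unfolding inj1_def using x
    by (cases "b = \<bottom>\<^bsub>M\<^esub>") (auto intro: L.sup_least)
next
  fix a B assume h: "a \<in> carrier L" "B \<subseteq> carrier M" "\<And>b. b \<in> B \<Longrightarrow> (a,b) \<in> inj1 L M x"
  show "(a, \<Squnion>\<^bsub>M\<^esub>B) \<in> inj1 L M x"
  proof (cases "a \<sqsubseteq>\<^bsub>L\<^esub> x")
    case False
    then have "\<And>b. b \<in> B \<Longrightarrow> b = \<bottom>\<^bsub>M\<^esub>" using h unfolding inj1_def by auto
    then have "\<Squnion>\<^bsub>M\<^esub>B = \<bottom>\<^bsub>M\<^esub>" using h by (intro M.sup_eqI) auto
    then show ?thesis using h unfolding inj1_def by auto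
  qed (use h in \<open>auto simp: inj1_def\<close>)
qed (auto simp: inj1_def)

lemma inj2_C: assumes x: "x \<in> carrier M" shows "inj2 L M x \<in> C_ideals L M"
proof (rule C_idealI)
  fix a b a' b' assume "a \<in> carrier L" "b \<in> carrier M" "(a', b') \<in> inj2 L M x" "a \<sqsubseteq>\<^bsub>L\<^esub> a'" "b \<sqsubseteq>\<^bsub>M\<^esub> b'"
  then show "(a, b) \<in> inj2 L M x" unfolding inj2_def
    using x L.bottom_le[of a] M.le_trans[of b b' x] by auto
next
  fix a B assume "B \<subseteq> carrier M" "a \<in> carrier L" "\<And>b. b \<in> B \<Longrightarrow> (a,b) \<in> inj2 L M x"
  then show "(a, \<Squnion>\<^bsub>M\<^esub>B) \<in> inj2 L M x" unfolding inj2_def using x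
    by (cases "a = \<bottom>\<^bsub>L\<^esub>") (auto intro: M.sup_least)
next
  fix A b assume h: "b \<in> carrier M" "A \<subseteq> carrier L" "\<And>a. a \<in> A \<Longrightarrow> (a,b) \<in> inj2 L M x"
  show "(\<Squnion>\<^bsub>L\<^esub>A, b) \<in> inj2 L M x"
  proof (cases "b \<sqsubseteq>\<^bsub>M\<^esub> x")
    case False
    then have "\<And>a. a \<in> A \<Longrightarrow> a = \<bottom>\<^bsub>L\<^esub>" using h unfolding inj2_def by auto
    then have "\<Squnion>\<^bsub>L\<^esub>A = \<bottom>\<^bsub>L\<^esub>" using h by (intro L.sup_eqI) auto
    then show ?thesis using h unfolding inj2_def by auto
  qed (use h in \<open>auto simp: inj2_def\<close>)
qed (auto simp: inj2_def)

lemma rect_eq: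
  assumes "x \<in> carrier L" "y \<in> carrier M"
  shows "rect L M x y = {(a, b) \<in> carrier L \<times> carrier M. a \<sqsubseteq>\<^bsub>L\<^esub> x \<and> b \<sqsubseteq>\<^bsub>M\<^esub> y \<or> a = \<bottom>\<^bsub>L\<^esub> \<or> b = \<bottom>\<^bsub>M\<^esub>}"
  unfolding rect_def coprod_meet[OF inj1_C[OF assms(1)] inj2_C[OF assms(2)]]
  using assms by (auto simp: inj1_def inj2_def)

lemma rect_C: "\<lbrakk>x \<in> carrier L; y \<in> carrier M\<rbrakk> \<Longrightarrow> rect L M x y \<in> C_ideals L M"
  unfolding rect_def using Int_C inj1_C inj2_C coprod_meet by metis

lemma coprod_top: "\<top>\<^bsub>L \<otimes>\<^sub>F M\<^esub> = carrier L \<times> carrier M"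
  using P.top_eqI[of "carrier L \<times> carrier M"] full C_idealD(1)[of _ L M] by simp

lemma inj1_sup: assumes A: "A \<subseteq> carrier L" 
  shows "inj1 L M (\<Squnion>\<^bsub>L\<^esub>A) = \<Squnion>\<^bsub>L \<otimes>\<^sub>F M\<^esub>(inj1 L M ` A)"
proof (rule P.sup_eqI[symmetric])
  show "inj1 L M ` A \<subseteq> carrier (L \<otimes>\<^sub>F M)" using A inj1_C by auto
  show "inj1 L M (\<Squnion>\<^bsub>L\<^esub>A) \<in> carrier (L \<otimes>\<^sub>F M)" using A inj1_C by auto
  show "x \<sqsubseteq>\<^bsub>L \<otimes>\<^sub>F M\<^esub> inj1 L M (\<Squnion>\<^bsub>L\<^esub>A)" if "x \<in> inj1 L M ` A" for x
    using that A by (auto simp: inj1_def) (meson L.le_trans L.sup_closed L.sup_upper subsetD)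
  fix z assume z: "z \<in> carrier (L \<otimes>\<^sub>F M)" "\<And>x. x \<in> inj1 L M ` A \<Longrightarrow> x \<sqsubseteq>\<^bsub>L \<otimes>\<^sub>F M\<^esub> z"
  have z': "z \<in> C_ideals L M" using z by simp
  have "(\<Squnion>\<^bsub>L\<^esub>A, b) \<in> z" if b: "b \<in> carrier M" for b
  proof (rule C_idealD(3)[OF z' A b])
    fix a assume a: "a \<in> A"
    then have "inj1 L M a \<subseteq> z" using z(2)[of "inj1 L M a"] by simp
    moreover have "(a, b) \<in> inj1 L M a" using a b A by (auto simp: inj1_def)
    ultimately show "(a, b) \<in> z" by (rule subsetD)
  qed
  then show "inj1 L M (\<Squnion>\<^bsub>L\<^esub>A) \<sqsubseteq>\<^bsub>L \<otimes>\<^sub>F M\<^esub> z"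
    by (auto simp: inj1_def A bot_R[OF z'] intro: C_idealD(2)[OF z', of _ _ "\<Squnion>\<^bsub>L\<^esub>A"])
qed

lemma inj2_sup: assumes A: "A \<subseteq> carrier M" 
  shows "inj2 L M (\<Squnion>\<^bsub>M\<^esub>A) = \<Squnion>\<^bsub>L \<otimes>\<^sub>F M\<^esub>(inj2 L M ` A)"
proof (rule P.sup_eqI[symmetric])
  show "inj2 L M ` A \<subseteq> carrier (L \<otimes>\<^sub>F M)" using A inj2_C by auto
  show "inj2 L M (\<Squnion>\<^bsub>M\<^esub>A) \<in> carrier (L \<otimes>\<^sub>F M)" using A inj2_C by auto
  show "x \<sqsubseteq>\<^bsub>L \<otimes>\<^sub>F M\<^esub> inj2 L M (\<Squnion>\<^bsub>M\<^esub>A)" if "x \<in> inj2 L M ` A" for x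
    using that A by (auto simp: inj2_def) (meson M.le_trans M.sup_closed M.sup_upper subsetD)
  fix z assume z: "z \<in> carrier (L \<otimes>\<^sub>F M)" "\<And>x. x \<in> inj2 L M ` A \<Longrightarrow> x \<sqsubseteq>\<^bsub>L \<otimes>\<^sub>F M\<^esub> z"
  have z': "z \<in> C_ideals L M" using z by simp
  have "(a, \<Squnion>\<^bsub>M\<^esub>A) \<in> z" if a: "a \<in> carrier L" for a
  proof (rule C_idealD(4)[OF z' a A])
    fix b assume b: "b \<in> A"
    then have "inj2 L M b \<subseteq> z" using z(2)[of "inj2 L M b"] by simp
    moreover have "(a, b) \<in> inj2 L M b" using a b A by (auto simp: inj2_def)
    ultimately show "(a, b) \<in> z" by (rule subsetD)
  qed
  then show "inj2 L M (\<Squnion>\<^bsub>M\<^esub>A) \<sqsubseteq>\<^bsub>L \<otimes>\<^sub>F M\<^esub> z"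
    by (auto simp: inj2_def A bot_L[OF z'] intro: C_idealD(2)[OF z', of _ _ _ "\<Squnion>\<^bsub>M\<^esub>A"])
qed

lemma inj1_frame_map: "frame_map L (L \<otimes>\<^sub>F M) (inj1 L M)"
  unfolding frame_map_def join_preserving_def
proof (intro conjI ballI allI impI)
  show "inj1 L M \<in> carrier L \<rightarrow> carrier (L \<otimes>\<^sub>F M)" using inj1_C by auto
  show "inj1 L M \<top>\<^bsub>L\<^esub> = \<top>\<^bsub>L \<otimes>\<^sub>F M\<^esub>" unfolding coprod_top by (auto simp: inj1_def)
  fix x y assume xy: "x \<in> carrier L" "y \<in> carrier L"
  then show "inj1 L M (x \<sqinter>\<^bsub>L\<^esub> y) = inj1 L M x \<sqinter>\<^bsub>L \<otimes>\<^sub>F M\<^esub> inj1 L M y"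
    unfolding coprod_meet[OF inj1_C[OF xy(1)] inj1_C[OF xy(2)]]
    by (auto simp: inj1_def L.le_meet_iff)
qed (use inj1_sup in auto)

lemma inj2_frame_map: "frame_map M (L \<otimes>\<^sub>F M) (inj2 L M)"
  unfolding frame_map_def join_preserving_def
proof (intro conjI ballI allI impI)
  show "inj2 L M \<in> carrier M \<rightarrow> carrier (L \<otimes>\<^sub>F M)" using inj2_C by auto
  show "inj2 L M \<top>\<^bsub>M\<^esub> = \<top>\<^bsub>L \<otimes>\<^sub>F M\<^esub>" unfolding coprod_top by (auto simp: inj2_def)
  fix x y assume xy: "x \<in> carrier M" "y \<in> carrier M"
  then show "inj2 L M (x \<sqinter>\<^bsub>M\<^esub> y) = inj2 L M x \<sqinter>\<^bsub>L \<otimes>\<^sub>F M\<^esub> inj2 L M y"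
    unfolding coprod_meet[OF inj2_C[OF xy(1)] inj2_C[OF xy(2)]]
    by (auto simp: inj2_def M.le_meet_iff)
qed (use inj2_sup in auto)

lemma rect_generate:
  assumes U: "U \<in> C_ideals L M"
  shows "U = \<Squnion>\<^bsub>L \<otimes>\<^sub>F M\<^esub>((\<lambda>(a, b). rect L M a b) ` U)"
proof (rule P.sup_eqI[symmetric])
  have c: "a \<in> carrier L" "b \<in> carrier M" if "(a,b) \<in> U" for a b using that C_idealD(1)[OF U] by auto
  show "(\<lambda>(a, b). rect L M a b) ` U \<subseteq> carrier (L \<otimes>\<^sub>F M)" using rect_C c by auto
  show "U \<in> carrier (L \<otimes>\<^sub>F M)" using U by simp
  show "x \<sqsubseteq>\<^bsub>L \<otimes>\<^sub>F M\<^esub> U" if x: "x \<in> (\<lambda>(a, b). rect L M a b) ` U" for x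
  proof -
    obtain a b where ab: "(a,b) \<in> U" "x = rect L M a b" using x by auto
    show ?thesis unfolding ab(2) rect_eq[OF c[OF ab(1)]]
      by (auto simp: bot_L[OF U] bot_R[OF U] intro: C_idealD(2)[OF U _ _ ab(1)])
  qed
  show "U \<sqsubseteq>\<^bsub>L \<otimes>\<^sub>F M\<^esub> z" if "\<And>x. x \<in> (\<lambda>(a, b). rect L M a b) ` U \<Longrightarrow> x \<sqsubseteq>\<^bsub>L \<otimes>\<^sub>F M\<^esub> z" for z
  proof -
    have "(a,b) \<in> z" if "(a,b) \<in> U" for a b
    proof -
      have "rect L M a b \<subseteq> z" using that \<open>\<And>x. _ \<Longrightarrow> x \<sqsubseteq>\<^bsub>L \<otimes>\<^sub>F M\<^esub> z\<close> by force
      moreover have "(a,b) \<in> rect L M a b" using c[OF that] by (auto simp: rect_eq)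
      ultimately show ?thesis by auto
    qed
    then show ?thesis by auto
  qed
qed

end

lemma frame_mapD:
  assumes "frame_map L M f"
  shows "x \<in> carrier L \<Longrightarrow> f x \<in> carrier M" "f \<top>\<^bsub>L\<^esub> = \<top>\<^bsub>M\<^esub>"
    "\<lbrakk>x \<in> carrier L; y \<in> carrier L\<rbrakk> \<Longrightarrow> f (x \<sqinter>\<^bsub>L\<^esub> y) = f x \<sqinter>\<^bsub>M\<^esub> f y"
    "A \<subseteq> carrier L \<Longrightarrow> f (\<Squnion>\<^bsub>L\<^esub>A) = \<Squnion>\<^bsub>M\<^esub>(f ` A)"
  using assms unfolding frame_map_def join_preserving_def by auto

lemma frame_map_mono:
  assumes "frame L" "frame M" "frame_map L M f" "x \<in> carrier L" "y \<in> carrier L" "x \<sqsubseteq>\<^bsub>L\<^esub> y"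
  shows "f x \<sqsubseteq>\<^bsub>M\<^esub> f y"
proof -
  interpret L: frame L by fact
  interpret M: frame M by fact
  have "x \<sqinter>\<^bsub>L\<^esub> y = x" using assms by (auto intro: L.meet_eqI)
  then have "f x = f x \<sqinter>\<^bsub>M\<^esub> f y" using frame_mapD(3)[OF assms(3), of x y] assms by simp
  then show ?thesis using M.meet_right[of "f x" "f y"] frame_mapD(1)[OF assms(3)] assms by simp
qed

lemma frame_map_bot:
  assumes "frame L" "frame M" "frame_map L M f" shows "f \<bottom>\<^bsub>L\<^esub> = \<bottom>\<^bsub>M\<^esub>"
  using frame.sup_empty_eq[OF assms(1)] frame.sup_empty_eq[OF assms(2)] frame_mapD(4)[OF assms(3), of "{}"] by simp

locale cocone = two_frames L M + N: frame N for L :: "('a,'c) gorder_scheme" and M :: "('b,'d) gorder_scheme"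
  and N :: "('n,'e) gorder_scheme" +
  fixes f g assumes f: "frame_map L N f" and g: "frame_map M N g"
begin

abbreviation "m \<equiv> \<lambda>(a, b). f a \<sqinter>\<^bsub>N\<^esub> g b"

lemma m_closed: "U \<in> C_ideals L M \<Longrightarrow> m ` U \<subseteq> carrier N"
  using C_idealD(1)[of U L M] frame_mapD(1)[OF f] frame_mapD(1)[OF g] by auto

lemma copair_closed: "U \<in> C_ideals L M \<Longrightarrow> copair N f g U \<in> carrier N"
  unfolding copair_def by (rule N.sup_closed[OF m_closed])

lemma m_mono: "\<lbrakk>a \<in> carrier L; b \<in> carrier M; a' \<in> carrier L; b' \<in> carrier M; a \<sqsubseteq>\<^bsub>L\<^esub> a'; b \<sqsubseteq>\<^bsub>M\<^esub> b'\<rbrakk> \<Longrightarrow> f a \<sqinter>\<^bsub>N\<^esub> g b \<sqsubseteq>\<^bsub>N\<^esub> f a' \<sqinter>\<^bsub>N\<^esub> g b'"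
  by (rule N.meet_mono)
    (simp_all add: frame_mapD(1)[OF f] frame_mapD(1)[OF g] frame_map_mono[OF L.frame_axioms N.frame_axioms f]
      frame_map_mono[OF M.frame_axioms N.frame_axioms g])

lemma below_C:
  assumes z: "z \<in> carrier N"
  shows "{(a,b) \<in> carrier L \<times> carrier M. f a \<sqinter>\<^bsub>N\<^esub> g b \<sqsubseteq>\<^bsub>N\<^esub> z} \<in> C_ideals L M" (is "?W \<in> _")
proof (rule C_idealI)
  fix a b a' b' assume h: "a \<in> carrier L" "b \<in> carrier M" "(a', b') \<in> ?W" "a \<sqsubseteq>\<^bsub>L\<^esub> a'" "b \<sqsubseteq>\<^bsub>M\<^esub> b'"
  have "f a \<sqinter>\<^bsub>N\<^esub> g b \<sqsubseteq>\<^bsub>N\<^esub> f a' \<sqinter>\<^bsub>N\<^esub> g b'" using h by (auto intro: m_mono)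
  then have "f a \<sqinter>\<^bsub>N\<^esub> g b \<sqsubseteq>\<^bsub>N\<^esub> z" 
    by (rule N.le_trans) (use h z frame_mapD(1)[OF f] frame_mapD(1)[OF g] in auto)
  then show "(a,b) \<in> ?W" using h by auto
next
  fix A b assume h: "A \<subseteq> carrier L" "b \<in> carrier M" "\<And>a. a \<in> A \<Longrightarrow> (a,b) \<in> ?W"
  have fA: "f ` A \<subseteq> carrier N" using h frame_mapD(1)[OF f] by auto
  have gb: "g b \<in> carrier N" using h frame_mapD(1)[OF g] by auto
  have "f (\<Squnion>\<^bsub>L\<^esub>A) \<sqinter>\<^bsub>N\<^esub> g b \<sqsubseteq>\<^bsub>N\<^esub> z" 
    unfolding frame_mapD(4)[OF f h(1)] N.sup_meet_distrib[OF gb fA]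
    by (rule N.sup_least) (use fA gb z h in \<open>auto simp: image_subset_iff\<close>)
  then show "(\<Squnion>\<^bsub>L\<^esub>A, b) \<in> ?W" using h by auto
next
  fix a B assume h: "a \<in> carrier L" "B \<subseteq> carrier M" "\<And>b. b \<in> B \<Longrightarrow> (a,b) \<in> ?W"
  have gB: "g ` B \<subseteq> carrier N" using h frame_mapD(1)[OF g] by auto
  have fa: "f a \<in> carrier N" using h frame_mapD(1)[OF f] by auto
  have "f a \<sqinter>\<^bsub>N\<^esub> g (\<Squnion>\<^bsub>M\<^esub>B) \<sqsubseteq>\<^bsub>N\<^esub> z" 
    unfolding frame_mapD(4)[OF g h(2)] N.meet_sup_distrib[OF fa gB]
    by (rule N.sup_least) (use gB fa z h in \<open>auto simp: image_subset_iff\<close>)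
  then show "(a, \<Squnion>\<^bsub>M\<^esub>B) \<in> ?W" using h by auto
qed auto

lemma copair_le_iff:
  assumes U: "U \<in> C_ideals L M" and z: "z \<in> carrier N"
  shows "copair N f g U \<sqsubseteq>\<^bsub>N\<^esub> z \<longleftrightarrow> U \<subseteq> {(a,b) \<in> carrier L \<times> carrier M. f a \<sqinter>\<^bsub>N\<^esub> g b \<sqsubseteq>\<^bsub>N\<^esub> z}" (is "?l \<longleftrightarrow> U \<subseteq> ?W")
proof
  assume "U \<subseteq> ?W" then show ?l unfolding copair_def
    by (intro N.sup_least m_closed U z) auto
next
  assume l: ?l
  have "m p \<sqsubseteq>\<^bsub>N\<^esub> z" if "p \<in> U" for p 
  proof -
    have mp: "m p \<in> m ` U" using that by (rule imageI)
    have "m p \<sqsubseteq>\<^bsub>N\<^esub> copair N f g U" unfolding copair_def by (rule N.sup_upper[OF m_closed[OF U] mp])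
    then show ?thesis by (rule N.le_trans) (use l z copair_closed[OF U] m_closed[OF U] mp in auto)
  qed
  then show "U \<subseteq> ?W" using C_idealD(1)[OF U] by fastforce
qed

lemma copair_sup:
  assumes S: "S \<subseteq> C_ideals L M"
  shows "copair N f g (\<Squnion>\<^bsub>L \<otimes>\<^sub>F M\<^esub>S) = \<Squnion>\<^bsub>N\<^esub>(copair N f g ` S)"
proof -
  have SS: "S \<subseteq> carrier (L \<otimes>\<^sub>F M)" using S by simp
  have J: "\<Squnion>\<^bsub>L \<otimes>\<^sub>F M\<^esub>S \<in> C_ideals L M" using P.sup_closed[OF SS] by simp
  show ?thesis
  proof (rule N.sup_eqI[symmetric])
    show "copair N f g ` S \<subseteq> carrier N" using S copair_closed by auto
    show "copair N f g (\<Squnion>\<^bsub>L \<otimes>\<^sub>F M\<^esub>S) \<in> carrier N" using copair_closed J by auto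
    fix x assume "x \<in> copair N f g ` S"
    then obtain U where U: "U \<in> S" "x = copair N f g U" by auto
    then have UC: "U \<in> C_ideals L M" using S by auto
    have "U \<subseteq> \<Squnion>\<^bsub>L \<otimes>\<^sub>F M\<^esub>S" using P.sup_upper[OF SS U(1)] by simp
    also have "\<dots> \<subseteq> {(a,b) \<in> carrier L \<times> carrier M. f a \<sqinter>\<^bsub>N\<^esub> g b \<sqsubseteq>\<^bsub>N\<^esub> copair N f g (\<Squnion>\<^bsub>L \<otimes>\<^sub>F M\<^esub>S)}"
      using copair_le_iff[OF J copair_closed[OF J]] copair_closed[OF J] by simp
    finally show "x \<sqsubseteq>\<^bsub>N\<^esub> copair N f g (\<Squnion>\<^bsub>L \<otimes>\<^sub>F M\<^esub>S)"
      using copair_le_iff[OF UC copair_closed[OF J]] U(2) by simp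
  next
    fix z assume z: "z \<in> carrier N" "\<And>x. x \<in> copair N f g ` S \<Longrightarrow> x \<sqsubseteq>\<^bsub>N\<^esub> z"
    have "U \<subseteq> {(a,b) \<in> carrier L \<times> carrier M. f a \<sqinter>\<^bsub>N\<^esub> g b \<sqsubseteq>\<^bsub>N\<^esub> z}" if "U \<in> S" for U
      using copair_le_iff[OF _ z(1), of U] z(2)[of "copair N f g U"] that S by blast
    then have "\<Squnion>\<^bsub>L \<otimes>\<^sub>F M\<^esub>S \<subseteq> {(a,b) \<in> carrier L \<times> carrier M. f a \<sqinter>\<^bsub>N\<^esub> g b \<sqsubseteq>\<^bsub>N\<^esub> z}"
      using P.sup_least[OF SS, of "{(a,b) \<in> carrier L \<times> carrier M. f a \<sqinter>\<^bsub>N\<^esub> g b \<sqsubseteq>\<^bsub>N\<^esub> z}"] below_C[OF z(1)] by simp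
    then show "copair N f g (\<Squnion>\<^bsub>L \<otimes>\<^sub>F M\<^esub>S) \<sqsubseteq>\<^bsub>N\<^esub> z" using copair_le_iff[OF J z(1)] by simp
  qed
qed

lemma copair_rect:
  assumes "x \<in> carrier L" "y \<in> carrier M"
  shows "copair N f g (rect L M x y) = f x \<sqinter>\<^bsub>N\<^esub> g y"
proof -
  have fg: "f x \<in> carrier N" "g y \<in> carrier N" using assms frame_mapD(1)[OF f] frame_mapD(1)[OF g] by auto
  have m: "f x \<sqinter>\<^bsub>N\<^esub> g y \<in> carrier N" using fg by simp
  show ?thesis
  proof (rule N.le_antisym)
    have bot: "f \<bottom>\<^bsub>L\<^esub> = \<bottom>\<^bsub>N\<^esub>" "g \<bottom>\<^bsub>M\<^esub> = \<bottom>\<^bsub>N\<^esub>"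
      using frame_map_bot[OF L.frame_axioms N.frame_axioms f] frame_map_bot[OF M.frame_axioms N.frame_axioms g] .
    have bb: "\<bottom>\<^bsub>N\<^esub> \<sqinter>\<^bsub>N\<^esub> a = \<bottom>\<^bsub>N\<^esub>" "a \<sqinter>\<^bsub>N\<^esub> \<bottom>\<^bsub>N\<^esub> = \<bottom>\<^bsub>N\<^esub>" if "a \<in> carrier N" for a
      using N.bottom_meet[OF that] by (simp_all add: N.eq_is_equal meet_comm)
    show "copair N f g (rect L M x y) \<sqsubseteq>\<^bsub>N\<^esub> f x \<sqinter>\<^bsub>N\<^esub> g y"
      unfolding copair_le_iff[OF rect_C[OF assms] m]
      using assms m frame_mapD(1)[OF f] frame_mapD(1)[OF g] by (auto simp: rect_eq bot bb intro: m_mono)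
    have "(x,y) \<in> rect L M x y" using assms by (auto simp: rect_eq)
    then show "f x \<sqinter>\<^bsub>N\<^esub> g y \<sqsubseteq>\<^bsub>N\<^esub> copair N f g (rect L M x y)"
      unfolding copair_def using N.sup_upper[OF m_closed[OF rect_C[OF assms]]] by force
  qed (use m copair_closed[OF rect_C[OF assms]] in auto)
qed

lemma tops: "\<top>\<^bsub>L\<^esub> \<in> carrier L" "\<top>\<^bsub>M\<^esub> \<in> carrier M" by auto

lemma inj1_rect: "x \<in> carrier L \<Longrightarrow> inj1 L M x = rect L M x \<top>\<^bsub>M\<^esub>"
  by (subst rect_eq) (auto simp: inj1_def)
lemma inj2_rect: "y \<in> carrier M \<Longrightarrow> inj2 L M y = rect L M \<top>\<^bsub>L\<^esub> y"
  by (subst rect_eq) (auto simp: inj2_def)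

lemma copair_inj1: "x \<in> carrier L \<Longrightarrow> copair N f g (inj1 L M x) = f x"
  using N.top_meet[of "f x"] frame_mapD(1)[OF f]
  by (simp add: inj1_rect copair_rect frame_mapD(2)[OF g] N.eq_is_equal meet_comm)
lemma copair_inj2: "y \<in> carrier M \<Longrightarrow> copair N f g (inj2 L M y) = g y"
  using N.top_meet[of "g y"] frame_mapD(1)[OF g]
  by (simp add: inj2_rect copair_rect frame_mapD(2)[OF f] N.eq_is_equal)

lemma copair_meet_le:
  assumes U: "U \<in> C_ideals L M" and V: "V \<in> C_ideals L M"
  shows "copair N f g U \<sqinter>\<^bsub>N\<^esub> copair N f g V \<sqsubseteq>\<^bsub>N\<^esub> copair N f g (U \<inter> V)"
proof -
  let ?z = "copair N f g (U \<inter> V)"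
  have z: "?z \<in> carrier N" using copair_closed[OF Int_C[OF U V]] .
  have key: "m p \<sqinter>\<^bsub>N\<^esub> m q \<sqsubseteq>\<^bsub>N\<^esub> ?z" if "p \<in> U" "q \<in> V" for p q
  proof -
    obtain a b c e where pq: "p = (a,b)" "q = (c,e)" by (cases p, cases q)
    have c: "a \<in> carrier L" "b \<in> carrier M" "c \<in> carrier L" "e \<in> carrier M"
      using pq that C_idealD(1)[OF U] C_idealD(1)[OF V] by auto
    have fc: "f a \<in> carrier N" "g b \<in> carrier N" "f c \<in> carrier N" "g e \<in> carrier N" 
      using c frame_mapD(1)[OF f] frame_mapD(1)[OF g] by auto
    have UV: "(a \<sqinter>\<^bsub>L\<^esub> c, b \<sqinter>\<^bsub>M\<^esub> e) \<in> U \<inter> V" 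
      using C_idealD(2)[OF U, of "a \<sqinter>\<^bsub>L\<^esub> c" "b \<sqinter>\<^bsub>M\<^esub> e" a b] C_idealD(2)[OF V, of "a \<sqinter>\<^bsub>L\<^esub> c" "b \<sqinter>\<^bsub>M\<^esub> e" c e] c that pq
      by (auto simp: L.meet_left L.meet_right M.meet_left M.meet_right)
    have "m p \<sqinter>\<^bsub>N\<^esub> m q = m (a \<sqinter>\<^bsub>L\<^esub> c, b \<sqinter>\<^bsub>M\<^esub> e)" 
      using fc pq by (simp add: frame_mapD(3)[OF f] frame_mapD(3)[OF g] c)
       (metis N.meet_assoc N.meet_closed meet_comm)
    also have "\<dots> \<sqsubseteq>\<^bsub>N\<^esub> ?z" unfolding copair_def by (rule N.sup_upper[OF m_closed[OF Int_C[OF U V]] imageI[OF UV]])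
    finally show ?thesis .
  qed
  have mU: "m ` U \<subseteq> carrier N" "m ` V \<subseteq> carrier N" using m_closed U V by auto
  have cU: "copair N f g U \<in> carrier N" using copair_closed U by auto
  have 1: "m p \<sqinter>\<^bsub>N\<^esub> copair N f g V \<sqsubseteq>\<^bsub>N\<^esub> ?z" if p: "p \<in> U" for p
  proof -
    have mp: "m p \<in> carrier N" using p mU by blast
    show ?thesis unfolding copair_def[of N f g V] N.meet_sup_distrib[OF mp mU(2)]
    proof (rule N.sup_least)
      show "(\<sqinter>\<^bsub>N\<^esub>) (m p) ` m ` V \<subseteq> carrier N" using mp mU by (auto simp: image_subset_iff)
      show "x \<sqsubseteq>\<^bsub>N\<^esub> ?z" if "x \<in> (\<sqinter>\<^bsub>N\<^esub>) (m p) ` m ` V" for x using that key[OF p] by (auto simp del: split_paired_All)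
    qed (rule z)
  qed
  have cV: "copair N f g V \<in> carrier N" using copair_closed V by auto
  show ?thesis unfolding copair_def[of N f g U] N.sup_meet_distrib[OF cV mU(1)]
    proof (rule N.sup_least)
      show "(\<lambda>y. y \<sqinter>\<^bsub>N\<^esub> copair N f g V) ` m ` U \<subseteq> carrier N" using cV mU by (auto simp: image_subset_iff)
      show "x \<sqsubseteq>\<^bsub>N\<^esub> ?z" if "x \<in> (\<lambda>y. y \<sqinter>\<^bsub>N\<^esub> copair N f g V) ` m ` U" for x using that 1 by auto
    qed (rule z)
qed

lemma copair_mono:
  assumes U: "U \<in> C_ideals L M" and V: "V \<in> C_ideals L M" and UV: "U \<subseteq> V"
  shows "copair N f g U \<sqsubseteq>\<^bsub>N\<^esub> copair N f g V"
  using copair_le_iff[OF U copair_closed[OF V]] copair_le_iff[OF V copair_closed[OF V]]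
    N.le_refl[OF copair_closed[OF V]] UV by simp

lemma copair_frame_map: "frame_map (L \<otimes>\<^sub>F M) N (copair N f g)"
  unfolding frame_map_def join_preserving_def
proof (intro conjI ballI allI impI)
  show "copair N f g \<in> carrier (L \<otimes>\<^sub>F M) \<rightarrow> carrier N" using copair_closed by auto
  show "copair N f g (\<Squnion>\<^bsub>L \<otimes>\<^sub>F M\<^esub>S) = \<Squnion>\<^bsub>N\<^esub>(copair N f g ` S)" if "S \<subseteq> carrier (L \<otimes>\<^sub>F M)" for S
    using that copair_sup by auto
  have "\<top>\<^bsub>L \<otimes>\<^sub>F M\<^esub> = inj1 L M \<top>\<^bsub>L\<^esub>" using inj1_frame_map frame_mapD(2) by metis
  then show "copair N f g \<top>\<^bsub>L \<otimes>\<^sub>F M\<^esub> = \<top>\<^bsub>N\<^esub>" by (simp add: copair_inj1 frame_mapD(2)[OF f])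
  fix U V assume "U \<in> carrier (L \<otimes>\<^sub>F M)" "V \<in> carrier (L \<otimes>\<^sub>F M)"
  then have UV: "U \<in> C_ideals L M" "V \<in> C_ideals L M" by auto
  show "copair N f g (U \<sqinter>\<^bsub>L \<otimes>\<^sub>F M\<^esub> V) = copair N f g U \<sqinter>\<^bsub>N\<^esub> copair N f g V"
    unfolding coprod_meet[OF UV]
    by (rule N.le_antisym) (use UV in \<open>auto intro!: copair_meet_le copair_closed Int_C N.meet_le copair_mono N.meet_closed\<close>)
qed

lemma copair_unique:
  assumes h: "frame_map (L \<otimes>\<^sub>F M) N h" "\<And>x. x \<in> carrier L \<Longrightarrow> h (inj1 L M x) = f x"
    "\<And>y. y \<in> carrier M \<Longrightarrow> h (inj2 L M y) = g y" and U: "U \<in> carrier (L \<otimes>\<^sub>F M)"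
  shows "h U = copair N f g U"
proof -
  have U: "U \<in> C_ideals L M" using U by simp
  have c: "a \<in> carrier L \<and> b \<in> carrier M" if "(a,b) \<in> U" for a b using that C_idealD(1)[OF U] by auto
  have s: "(\<lambda>(a, b). rect L M a b) ` U \<subseteq> carrier (L \<otimes>\<^sub>F M)" using rect_C c by auto
  have "h U = \<Squnion>\<^bsub>N\<^esub>(h ` (\<lambda>(a, b). rect L M a b) ` U)"
    by (subst rect_generate[OF U]) (rule frame_mapD(4)[OF h(1) s])
  also have "h ` (\<lambda>(a, b). rect L M a b) ` U = m ` U"
  proof -
    have "h (rect L M a b) = f a \<sqinter>\<^bsub>N\<^esub> g b" if "(a,b) \<in> U" for a b
      unfolding rect_def using c[OF that] by (simp add: frame_mapD(3)[OF h(1)] inj1_C inj2_C h)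
    then show ?thesis unfolding image_image by (intro image_cong) auto
  qed
  finally show ?thesis unfolding copair_def .
qed

end

subsection \<open>The quotient and its universal property\<close>

context frame begin

definition heyting_imp :: "'a \<Rightarrow> 'a \<Rightarrow> 'a" where "heyting_imp x y = \<Squnion>{w \<in> carrier L. x \<sqinter> w \<sqsubseteq> y}"

lemma imp_closed: "heyting_imp x y \<in> carrier L" unfolding heyting_imp_def by (rule sup_closed) auto

lemma imp_iff: assumes "x \<in> carrier L" "y \<in> carrier L" "w \<in> carrier L"
  shows "w \<sqsubseteq> heyting_imp x y \<longleftrightarrow> x \<sqinter> w \<sqsubseteq> y"
proof
  assume "x \<sqinter> w \<sqsubseteq> y" then show "w \<sqsubseteq> heyting_imp x y" unfolding heyting_imp_def using assms by (intro sup_upper) auto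
next
  assume w: "w \<sqsubseteq> heyting_imp x y"
  have "x \<sqinter> heyting_imp x y \<sqsubseteq> y" unfolding heyting_imp_def
    by (subst meet_sup_distrib) (use assms in \<open>auto intro!: sup_least\<close>)
  moreover have "x \<sqinter> w \<sqsubseteq> x \<sqinter> heyting_imp x y" using w assms imp_closed by (intro meet_mono) auto
  ultimately show "x \<sqinter> w \<sqsubseteq> y" using le_trans assms imp_closed meet_closed by meson
qed

lemma le_inf_iff: "\<lbrakk>A \<subseteq> carrier L; z \<in> carrier L\<rbrakk> \<Longrightarrow> z \<sqsubseteq> \<Sqinter>A \<longleftrightarrow> (\<forall>a\<in>A. z \<sqsubseteq> a)"
  by (meson inf_closed inf_greatest inf_lower le_trans subsetD)

lemma saturatedD:
  assumes "x \<in> saturated L E" "(p, q) \<in> E" "w \<in> carrier L"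
  shows "p \<sqinter> w \<sqsubseteq> x \<longleftrightarrow> q \<sqinter> w \<sqsubseteq> x"
  using bspec[OF conjunct2[OF assms(1)[unfolded saturated_def mem_Collect_eq]] assms(2)] assms(3) by simp

lemma sat_Inf:
  assumes E: "E \<subseteq> carrier L \<times> carrier L" and S: "S \<subseteq> saturated L E"
  shows "\<Sqinter>S \<in> saturated L E"
proof -
  have "S \<subseteq> carrier L" using S by (auto simp: saturated_def)
  then have "p \<sqinter> w \<sqsubseteq> \<Sqinter>S \<longleftrightarrow> q \<sqinter> w \<sqsubseteq> \<Sqinter>S" if "(p,q) \<in> E" "w \<in> carrier L" for p q w
  proof -
    have c: "p \<in> carrier L" "q \<in> carrier L" using that E by auto
    have "p \<sqinter> w \<sqsubseteq> x \<longleftrightarrow> q \<sqinter> w \<sqsubseteq> x" if "x \<in> S" for x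
      by (rule saturatedD[of x E]) (use that S \<open>(p,q) \<in> E\<close> \<open>w \<in> carrier L\<close> in auto)
    then show ?thesis using c \<open>S \<subseteq> carrier L\<close> \<open>w \<in> carrier L\<close> by (simp add: le_inf_iff)
  qed
  then show ?thesis using \<open>S \<subseteq> carrier L\<close> by (auto simp: saturated_def)
qed

lemma sat_imp:
  assumes E: "E \<subseteq> carrier L \<times> carrier L" and y: "y \<in> saturated L E" and x: "x \<in> carrier L"
  shows "heyting_imp x y \<in> saturated L E"
proof -
  have yc: "y \<in> carrier L" using y by (auto simp: saturated_def)
  have "p \<sqinter> w \<sqsubseteq> heyting_imp x y \<longleftrightarrow> q \<sqinter> w \<sqsubseteq> heyting_imp x y" if pq: "(p,q) \<in> E" and w: "w \<in> carrier L" for p q w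
  proof -
    have c: "p \<in> carrier L" "q \<in> carrier L" using pq E by auto
    have r: "x \<sqinter> (r \<sqinter> w) = r \<sqinter> (x \<sqinter> w)" if "r \<in> carrier L" for r
      using that x w by (metis meet_assoc meet_comm)
    have "p \<sqinter> (x \<sqinter> w) \<sqsubseteq> y \<longleftrightarrow> q \<sqinter> (x \<sqinter> w) \<sqsubseteq> y" using saturatedD[OF y pq, of "x \<sqinter> w"] w x by simp
    then show ?thesis using c w x yc by (simp add: imp_iff r)
  qed
  then show ?thesis by (auto simp: saturated_def imp_closed)
qed
end

locale frame_quot = frame L for L (structure) + fixes E assumes E: "E \<subseteq> carrier L \<times> carrier L"
begin

lemma sat_sub: "saturated L E \<subseteq> carrier L" by (auto simp: saturated_def)

lemma quot_map_eq: assumes x: "x \<in> carrier L"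
  shows "quot_map L E x = \<Sqinter>{y \<in> saturated L E. x \<sqsubseteq> y}" "least L (quot_map L E x) {y \<in> saturated L E. x \<sqsubseteq> y}"
proof -
  let ?S = "{y \<in> saturated L E. x \<sqsubseteq> y}"
  have S: "?S \<subseteq> carrier L" using sat_sub by auto
  have "\<Sqinter>?S \<in> ?S" using sat_Inf[OF E, of ?S] x S by (auto simp: le_inf_iff[OF S x])
  then have l: "least L (\<Sqinter>?S) ?S" using S by (auto simp: least_def inf_lower)
  have "quot_map L E x = \<Sqinter>?S" unfolding quot_map_def
    by (rule the_equality[where P="\<lambda>m. least L m ?S", OF l]) (use l least_unique in blast)
  then show "quot_map L E x = \<Sqinter>?S" "least L (quot_map L E x) ?S" using l by simp_all
qed

lemma quot_sat: "x \<in> carrier L \<Longrightarrow> quot_map L E x \<in> saturated L E"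
  and quot_le: "x \<in> carrier L \<Longrightarrow> x \<sqsubseteq> quot_map L E x"
  and quot_least: "\<lbrakk>x \<in> carrier L; y \<in> saturated L E; x \<sqsubseteq> y\<rbrakk> \<Longrightarrow> quot_map L E x \<sqsubseteq> y"
  and quot_c: "x \<in> carrier L \<Longrightarrow> quot_map L E x \<in> carrier L"
  using quot_map_eq(2)[of x] by (auto simp: least_def)

lemma quot_le_iff:
  assumes x: "x \<in> carrier L" and y: "y \<in> saturated L E"
  shows "quot_map L E x \<sqsubseteq> y \<longleftrightarrow> x \<sqsubseteq> y"
  using quot_least[OF x y] le_trans[OF quot_le[OF x], of y] quot_c[OF x] x subsetD[OF sat_sub y] by auto

lemma quot_id:
  assumes x: "x \<in> saturated L E" shows "quot_map L E x = x"
proof -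
  have c: "x \<in> carrier L" using x sat_sub by auto
  show ?thesis using quot_le[OF c] quot_least[OF c x] quot_c[OF c] c by (auto intro: le_antisym)
qed

lemma quot_carrier[simp]: "carrier (quot_frame L E) = saturated L E"
  and quot_order[simp]: "le (quot_frame L E) = le L"
  and quot_eq[simp]: "eq (quot_frame L E) = eq L" by (auto simp: quot_frame_def)

lemma Q_complete: "complete_lattice (quot_frame L E)"
proof -
  interpret Q: partial_order "quot_frame L E"
    by unfold_locales (use sat_sub in \<open>auto simp: eq_is_equal intro: le_trans le_antisym\<close>)
  show ?thesis
  proof (rule Q.complete_lattice_criterion1)
    show "\<exists>g. greatest (quot_frame L E) g (carrier (quot_frame L E))"
      using sat_Inf[OF E, of "{}"] sat_sub by (intro exI[of _ "\<Sqinter>{}"]) (auto simp: greatest_def intro!: inf_greatest)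
    fix A assume A: "A \<subseteq> carrier (quot_frame L E)"
    then have "\<Sqinter>A \<in> saturated L E" "A \<subseteq> carrier L" using sat_Inf[OF E] sat_sub by auto
    then show "\<exists>i. greatest (quot_frame L E) i (Lower (quot_frame L E) A)"
      using A sat_sub by (intro exI[of _ "\<Sqinter>A"]) (auto simp: greatest_def Lower_def inf_lower le_inf_iff subset_iff)
  qed
qed

sublocale Q: complete_lattice "quot_frame L E" by (rule Q_complete)

lemma Q_meet: assumes "x \<in> saturated L E" "y \<in> saturated L E" shows "x \<sqinter>\<^bsub>quot_frame L E\<^esub> y = x \<sqinter> y"
proof -
  have c: "x \<in> carrier L" "y \<in> carrier L" using assms sat_sub by auto
  have s: "x \<sqinter> y \<in> saturated L E" unfolding meet_def using sat_Inf[OF E, of "{x,y}"] assms by simp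
  have "x \<sqinter>\<^bsub>quot_frame L E\<^esub> y \<in> saturated L E" using Q.meet_closed[of x y] assms by simp
  then show ?thesis using Q.meet_left[of x y] Q.meet_right[of x y] Q.meet_le[of "x \<sqinter> y" x y] s assms c sat_sub
    by (intro le_antisym) (auto intro!: meet_le simp: meet_left meet_right)
qed

lemma Q_sup: assumes "A \<subseteq> saturated L E" shows "\<Squnion>\<^bsub>quot_frame L E\<^esub>A = quot_map L E (\<Squnion>A)"
proof -
  have c: "A \<subseteq> carrier L" using assms sat_sub by auto
  have s: "\<Squnion>\<^bsub>quot_frame L E\<^esub>A \<in> saturated L E" using Q.sup_closed[of A] assms by simp
  show ?thesis
  proof (rule le_antisym)
    show "\<Squnion>\<^bsub>quot_frame L E\<^esub>A \<sqsubseteq> quot_map L E (\<Squnion>A)"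
    proof -
      have "x \<sqsubseteq> quot_map L E (\<Squnion>A)" if "x \<in> A" for x
        using that sup_upper[OF c that] quot_le[of "\<Squnion>A"] c quot_c[of "\<Squnion>A"] by (meson le_trans sup_closed subsetD)
      then show ?thesis using Q.sup_least[of A "quot_map L E (\<Squnion>A)"] assms quot_sat c by simp
    qed
    show "quot_map L E (\<Squnion>A) \<sqsubseteq> \<Squnion>\<^bsub>quot_frame L E\<^esub>A"
      using Q.sup_upper[of A] assms s c sat_sub by (subst quot_le_iff) (auto intro!: sup_least)
  qed (use s sat_sub quot_c c in auto)
qed

lemma sup_le_iff: "\<lbrakk>A \<subseteq> carrier L; z \<in> carrier L\<rbrakk> \<Longrightarrow> \<Squnion>A \<sqsubseteq> z \<longleftrightarrow> (\<forall>a\<in>A. a \<sqsubseteq> z)"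
  by (meson sup_closed sup_least sup_upper le_trans subsetD)

lemma quot_meet_le: assumes x: "x \<in> carrier L" and y: "y \<in> carrier L" and z: "z \<in> saturated L E" and "x \<sqinter> y \<sqsubseteq> z"
  shows "quot_map L E x \<sqinter> quot_map L E y \<sqsubseteq> z"
proof -
  have zc: "z \<in> carrier L" using z sat_sub by auto
  have "y \<sqsubseteq> heyting_imp x z" using assms zc by (simp add: imp_iff)
  then have "quot_map L E y \<sqsubseteq> heyting_imp x z" using quot_le_iff[OF y sat_imp[OF E z x]] by simp
  then have "quot_map L E y \<sqinter> x \<sqsubseteq> z" using imp_iff[OF x zc quot_c[OF y]] meet_comm by metis
  then have "x \<sqsubseteq> heyting_imp (quot_map L E y) z" using imp_iff[OF quot_c[OF y] zc x] by simp
  then have "quot_map L E x \<sqsubseteq> heyting_imp (quot_map L E y) z" using quot_le_iff[OF x sat_imp[OF E z quot_c[OF y]]] by simp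
  then show ?thesis using imp_iff[OF quot_c[OF y] zc quot_c[OF x]] meet_comm by metis
qed

lemma quot_meet: assumes x: "x \<in> carrier L" and y: "y \<in> carrier L" 
  shows "quot_map L E (x \<sqinter> y) = quot_map L E x \<sqinter> quot_map L E y"
proof (rule le_antisym)
  have s: "quot_map L E x \<sqinter> quot_map L E y \<in> saturated L E" unfolding meet_def 
    using sat_Inf[OF E, of "{quot_map L E x,quot_map L E y}"] assms quot_sat by simp
  show "quot_map L E (x \<sqinter> y) \<sqsubseteq> quot_map L E x \<sqinter> quot_map L E y"
    using x y by (subst quot_le_iff) (auto intro!: meet_mono quot_le quot_c s)
  show "quot_map L E x \<sqinter> quot_map L E y \<sqsubseteq> quot_map L E (x \<sqinter> y)"
    by (rule quot_meet_le) (use x y quot_sat quot_le in auto)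
qed (use x y quot_c in auto)

lemma quot_sup: assumes A: "A \<subseteq> carrier L"
  shows "quot_map L E (\<Squnion>A) = \<Squnion>\<^bsub>quot_frame L E\<^esub>(quot_map L E ` A)"
proof -
  have qA: "quot_map L E ` A \<subseteq> saturated L E" "quot_map L E ` A \<subseteq> carrier L" using A quot_sat quot_c by auto
  show ?thesis unfolding Q_sup[OF qA(1)]
  proof (rule le_antisym)
    have u: "a \<sqsubseteq> \<Squnion>(quot_map L E ` A)" if "a \<in> A" for a
      using sup_upper[OF qA(2), of "quot_map L E a"] quot_le[of a] that A qA 
      by (meson image_eqI le_trans quot_c subsetD sup_closed)
    have "\<Squnion>A \<sqsubseteq> \<Squnion>(quot_map L E ` A)" using u A qA by (intro sup_least) auto
    then show "quot_map L E (\<Squnion>A) \<sqsubseteq> quot_map L E (\<Squnion>(quot_map L E ` A))"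
      using A qA quot_le_iff[OF sup_closed[OF A] quot_sat[OF sup_closed[OF qA(2)]]] quot_le[OF sup_closed[OF qA(2)]]
      by (meson le_trans quot_c sup_closed)
    have "quot_map L E a \<sqsubseteq> quot_map L E (\<Squnion>A)" if "a \<in> A" for a
      using that A sup_upper[OF A that] quot_le[OF sup_closed[OF A]]
       quot_le_iff[of a "quot_map L E (\<Squnion>A)"] quot_sat[OF sup_closed[OF A]] 
      by (meson le_trans quot_c sup_closed subsetD)
    then show "quot_map L E (\<Squnion>(quot_map L E ` A)) \<sqsubseteq> quot_map L E (\<Squnion>A)"
      using A qA by (subst quot_le_iff) (auto intro!: sup_least quot_c quot_sat)
  qed (use A qA quot_c in auto)
qed

lemma quot_frame_frame: "frame (quot_frame L E)"
proof unfold_locales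
  fix x A assume x: "x \<in> carrier (quot_frame L E)" and A: "A \<subseteq> carrier (quot_frame L E)"
  then have x': "x \<in> saturated L E" "x \<in> carrier L" and A': "A \<subseteq> saturated L E" "A \<subseteq> carrier L" using sat_sub by auto
  have "x \<sqinter>\<^bsub>quot_frame L E\<^esub> \<Squnion>\<^bsub>quot_frame L E\<^esub>A = quot_map L E x \<sqinter> quot_map L E (\<Squnion>A)"
    using Q_sup[OF A'(1)] Q_meet[OF x'(1)] quot_sat A' by (simp add: quot_id[OF x'(1)])
  also have "\<dots> = quot_map L E (\<Squnion>((\<lambda>y. x \<sqinter> y) ` A))" 
    using quot_meet[OF x'(2) sup_closed[OF A'(2)]] meet_sup_distrib[OF x'(2) A'(2)] by simp
  also have "(\<lambda>y. x \<sqinter> y) ` A = (\<lambda>y. x \<sqinter>\<^bsub>quot_frame L E\<^esub> y) ` A"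
    using Q_meet[OF x'(1)] A'(1) by (intro image_cong) auto
  also have "quot_map L E (\<Squnion>\<dots>) = \<Squnion>\<^bsub>quot_frame L E\<^esub>((\<lambda>y. x \<sqinter>\<^bsub>quot_frame L E\<^esub> y) ` A)"
    by (rule Q_sup[symmetric]) (use Q.meet_closed x A in \<open>auto simp del: quot_carrier simp: quot_carrier[symmetric]\<close>)
  finally show "x \<sqinter>\<^bsub>quot_frame L E\<^esub> \<Squnion>\<^bsub>quot_frame L E\<^esub>A = \<Squnion>\<^bsub>quot_frame L E\<^esub>((\<lambda>y. x \<sqinter>\<^bsub>quot_frame L E\<^esub> y) ` A)" .
qed

lemma quot_frame_map: "frame_map L (quot_frame L E) (quot_map L E)"
  unfolding frame_map_def join_preserving_def
proof (intro conjI ballI allI impI)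
  show "quot_map L E \<in> carrier L \<rightarrow> carrier (quot_frame L E)" using quot_sat by auto
  show "quot_map L E (x \<sqinter> y) = quot_map L E x \<sqinter>\<^bsub>quot_frame L E\<^esub> quot_map L E y" if "x \<in> carrier L" "y \<in> carrier L" for x y
    using that by (simp add: quot_meet Q_meet quot_sat)
  show "quot_map L E \<top> = \<top>\<^bsub>quot_frame L E\<^esub>"
  proof (rule Q.top_eqI)
    show "quot_map L E \<top> \<in> carrier (quot_frame L E)" by (simp add: quot_sat)
    fix x assume "x \<in> carrier (quot_frame L E)"
    then have "x \<in> carrier L" using sat_sub by auto
    then have "x \<sqsubseteq> quot_map L E \<top>"
      using le_trans[OF top_higher quot_le[OF top_closed]] quot_c[OF top_closed] by simp
    then show "x \<sqsubseteq>\<^bsub>quot_frame L E\<^esub> quot_map L E \<top>" by simp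
  qed
qed (use quot_sup in auto)

lemma quot_surj: "quot_map L E ` carrier L = carrier (quot_frame L E)"
  using quot_sat quot_id sat_sub by (auto simp: image_iff) (metis subsetD)

lemma quot_identifies: assumes "(p,q) \<in> E" shows "quot_map L E p = quot_map L E q"
proof -
  have c: "p \<in> carrier L" "q \<in> carrier L" using assms E by auto
  have m: "r \<sqinter> \<top> = r" if "r \<in> carrier L" for r using top_meet[OF that] by (simp add: eq_is_equal meet_comm)
  have "p \<sqsubseteq> z \<longleftrightarrow> q \<sqsubseteq> z" if "z \<in> saturated L E" for z
    using saturatedD[OF that assms top_closed] m c by simp
  then show ?thesis using quot_le_iff quot_sat c quot_le by (meson le_antisym quot_c)
qed

lemma quot_universal:
  assumes N: "frame N" and h: "frame_map L N h" and hE: "\<And>p q. (p,q) \<in> E \<Longrightarrow> h p = h q" and x: "x \<in> carrier L"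
  shows "h (quot_map L E x) = h x"
proof -
  interpret N: frame N by fact
  let ?s = "\<Squnion>{w \<in> carrier L. h w \<sqsubseteq>\<^bsub>N\<^esub> h x}"
  have S: "{w \<in> carrier L. h w \<sqsubseteq>\<^bsub>N\<^esub> h x} \<subseteq> carrier L" by auto
  have sc: "?s \<in> carrier L" using S by simp
  have hx: "h x \<in> carrier N" using frame_mapD(1)[OF h x] .
  have hs: "h ?s \<sqsubseteq>\<^bsub>N\<^esub> h x" unfolding frame_mapD(4)[OF h S] using frame_mapD(1)[OF h] hx by (intro N.sup_least) auto
  have iff: "w \<sqsubseteq> ?s \<longleftrightarrow> h w \<sqsubseteq>\<^bsub>N\<^esub> h x" if w: "w \<in> carrier L" for w
    using sup_upper[OF S, of w] hs frame_map_mono[OF frame_axioms N h w sc] w frame_mapD(1)[OF h] sc hx N.le_trans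
    by (metis (mono_tags, lifting) mem_Collect_eq)
  have sat: "?s \<in> saturated L E"
    using E sc hE frame_mapD(3)[OF h] by (auto simp: saturated_def iff[OF meet_closed] subset_iff)
  have "x \<sqsubseteq> ?s" using iff[OF x] hx by auto
  then have "quot_map L E x \<sqsubseteq> ?s" using quot_le_iff[OF x sat] by simp
  then have "h (quot_map L E x) \<sqsubseteq>\<^bsub>N\<^esub> h x" using iff[OF quot_c[OF x]] by simp
  moreover have "h x \<sqsubseteq>\<^bsub>N\<^esub> h (quot_map L E x)" using frame_map_mono[OF frame_axioms N h x quot_c[OF x] quot_le[OF x]] .
  ultimately show ?thesis using frame_mapD(1)[OF h] x quot_c by (intro N.le_antisym) auto
qed

end

subsection \<open>Localic relations\<close>

lemma conic_rel_localic:
  assumes "conic_frame X u d" shows "localic_relation X (conic_rel X u d)"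
proof -
  interpret X: conic_frame X u d by fact
  interpret two_frames X X ..
  interpret frame_quot "X \<otimes>\<^sub>F X" "conic_sim X u d"
    by unfold_locales (auto simp: conic_sim_def rect_C)
  show ?thesis unfolding localic_relation_def is_sublocale_def conic_rel_def
    using quot_frame_frame quot_frame_map quot_surj by simp
qed

lemma diagonal_localic:
  assumes "frame X" shows "localic_relation X (diagonal X)"
proof -
  interpret X: frame X by fact
  have i: "frame_map X X id" by (auto simp: frame_map_def join_preserving_def)
  interpret cocone X X X id id by unfold_locales (rule i)+
  show ?thesis unfolding localic_relation_def is_sublocale_def diagonal_def
  proof (simp add: X.frame_axioms copair_frame_map, intro equalityI subsetI)
    fix x assume "x \<in> carrier X" 
    then show "x \<in> copair X id id ` C_ideals X X" 
      using copair_inj1[of x] inj1_C[of x] by (metis id_apply image_eqI)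
  qed (use copair_closed in auto)
qed

end

theory Submission
  imports Defs
begin

text \<open>
  Write \<open>s\<close> and \<open>t\<close> for the source and target frame maps of \<open>R\<close>. The inequalities
  \<open>s a \<sqsubseteq> t (u a)\<close> and \<open>t b \<sqsubseteq> s (d b)\<close> hold because \<open>a \<otimes> \<top> \<sim> a \<otimes> u a\<close> and
  \<open>\<top> \<otimes> b \<sim> d b \<otimes> b\<close>. Conversely, the assignments \<open>a \<otimes> b \<mapsto> u a \<sqinter> b\<close> and
  \<open>a \<otimes> b \<mapsto> a \<sqinter> d b\<close> respect \<open>\<sim>\<close>, by parallelism even after meeting both rectangles with a
  third one. Hence they descend to join-preserving maps out of \<open>R\<close>, which recover \<open>u\<close> and \<open>d\<close> from
  the relation. On the pullback that defines \<open>R \<circ> R\<close>, the same role is played by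
  \<open>a \<otimes> b, a' \<otimes> b' \<mapsto> u (u a \<sqinter> b \<sqinter> a') \<sqinter> b'\<close> and its dual.
\<close>

section \<open>Frame maps and join-preserving functions\<close>

lemma (in frame) top_meet_eq [simp]: "x \<in> carrier L \<Longrightarrow> \<top> \<sqinter> x = x" "x \<in> carrier L \<Longrightarrow> x \<sqinter> \<top> = x"
  by (auto intro!: meet_eqI)

lemma frame_map_comp:
  assumes "frame_map L M f" "frame_map M N g" shows "frame_map L N (g \<circ> f)"
  unfolding frame_map_def join_preserving_def
proof (intro conjI ballI allI impI)
  show "(g \<circ> f) (\<Squnion>\<^bsub>L\<^esub>A) = \<Squnion>\<^bsub>N\<^esub>((g \<circ> f) ` A)" if A: "A \<subseteq> carrier L" for A
  proof -
    have "f ` A \<subseteq> carrier M" using A frame_mapD(1)[OF assms(1)] by auto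
    then show ?thesis by (simp add: frame_mapD(4)[OF assms(1) A] frame_mapD(4)[OF assms(2)] image_comp)
  qed
qed (use frame_mapD[OF assms(1)] frame_mapD[OF assms(2)] in auto)

lemma (in frame) join_preserving_mono:
  assumes f: "join_preserving L L f" and xy: "x \<in> carrier L" "y \<in> carrier L" "x \<sqsubseteq> y"
  shows "f x \<sqsubseteq> f y"
proof -
  have c: "f x \<in> carrier L" "f y \<in> carrier L" using f xy by (auto simp: join_preserving_def)
  have "\<Squnion>{x, y} = y" using xy by (intro sup_eqI) auto
  then have "f y = \<Squnion>{f x, f y}" using f xy unfolding join_preserving_def by (metis empty_subsetI image_empty image_insert insert_subset)
  then show ?thesis using sup_upper[of "{f x, f y}" "f x"] c by simp
qed

lemma (in frame) join_preserving_id: "join_preserving L L (\<lambda>v. v)"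
  by (auto simp: join_preserving_def)

lemma join_preserving_comp:
  assumes "join_preserving L L f" "join_preserving L L g" shows "join_preserving L L (\<lambda>v. g (f v))"
  unfolding join_preserving_def
proof (intro conjI allI impI)
  show "(\<lambda>v. g (f v)) \<in> carrier L \<rightarrow> carrier L" using assms by (auto simp: join_preserving_def)
  fix A assume A: "A \<subseteq> carrier L"
  then have "f ` A \<subseteq> carrier L" using assms(1) by (auto simp: join_preserving_def)
  then show "g (f (\<Squnion>\<^bsub>L\<^esub>A)) = \<Squnion>\<^bsub>L\<^esub>((\<lambda>v. g (f v)) ` A)"
    using assms A by (simp add: join_preserving_def image_image)
qed

lemma (in frame) join_preserving_meet:
  assumes f: "join_preserving L L f" and x: "x \<in> carrier L"
  shows "join_preserving L L (\<lambda>v. f v \<sqinter> x)" "join_preserving L L (\<lambda>v. x \<sqinter> f v)"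
proof -
  have fA: "f ` A \<subseteq> carrier L" if "A \<subseteq> carrier L" for A using that f by (auto simp: join_preserving_def)
  then show "join_preserving L L (\<lambda>v. f v \<sqinter> x)" "join_preserving L L (\<lambda>v. x \<sqinter> f v)"
    using f x by (auto simp: join_preserving_def Pi_iff sup_meet_distrib meet_sup_distrib image_image)
qed

section \<open>Rectangles in a coproduct of frames\<close>

lemma (in two_frames) rect_subset_iff:
  assumes "T \<in> C_ideals L M" "x \<in> carrier L" "y \<in> carrier M"
  shows "rect L M x y \<subseteq> T \<longleftrightarrow> (x, y) \<in> T"
proof
  show "(x, y) \<in> T" if "rect L M x y \<subseteq> T" using that assms by (auto simp: rect_eq)
  show "rect L M x y \<subseteq> T" if "(x, y) \<in> T"
    using that assms bot_L bot_R by (auto simp: rect_eq intro: C_idealD(2)[OF assms(1)])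
qed

text \<open>Shrinking a pair of \<open>W\<close> to the rectangle keeps it in \<open>W\<close>, and
  a pair of \<open>W\<close> under the corner is below its own shrinking. This reduces the
  saturation test against an arbitrary \<open>W\<close> to a test on single pairs.\<close>

lemma (in two_frames) rect_meet_subset_iff:
  assumes T: "T \<in> C_ideals L M" and W: "W \<in> C_ideals L M" and x: "x \<in> carrier L" and y: "y \<in> carrier M"
  shows "rect L M x y \<sqinter>\<^bsub>L \<otimes>\<^sub>F M\<^esub> W \<subseteq> T \<longleftrightarrow> (\<forall>(a, b)\<in>W. (x \<sqinter>\<^bsub>L\<^esub> a, y \<sqinter>\<^bsub>M\<^esub> b) \<in> T)"
  unfolding coprod_meet[OF rect_C[OF x y] W]
proof (intro iffI ballI subsetI)
  fix p assume h: "rect L M x y \<inter> W \<subseteq> T" and p: "p \<in> W"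
  obtain a b where ab: "p = (a, b)" by (cases p)
  have c: "a \<in> carrier L" "b \<in> carrier M" using C_idealD(1)[OF W] p ab by auto
  have "(x \<sqinter>\<^bsub>L\<^esub> a, y \<sqinter>\<^bsub>M\<^esub> b) \<in> W"
    using C_idealD(2)[OF W _ _ p[unfolded ab]] c x y by (simp add: L.meet_right M.meet_right)
  moreover have "(x \<sqinter>\<^bsub>L\<^esub> a, y \<sqinter>\<^bsub>M\<^esub> b) \<in> rect L M x y"
    using c x y by (simp add: rect_eq L.meet_left M.meet_left)
  ultimately show "case p of (a, b) \<Rightarrow> (x \<sqinter>\<^bsub>L\<^esub> a, y \<sqinter>\<^bsub>M\<^esub> b) \<in> T" using h ab by auto
next
  fix p assume h: "\<forall>(a, b)\<in>W. (x \<sqinter>\<^bsub>L\<^esub> a, y \<sqinter>\<^bsub>M\<^esub> b) \<in> T" and p: "p \<in> rect L M x y \<inter> W"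
  obtain a b where ab: "p = (a, b)" by (cases p)
  have c: "a \<in> carrier L" "b \<in> carrier M" using C_idealD(1)[OF W] p ab by auto
  have m: "(x \<sqinter>\<^bsub>L\<^esub> a, y \<sqinter>\<^bsub>M\<^esub> b) \<in> T" using h p ab by auto
  from p ab consider "a \<sqsubseteq>\<^bsub>L\<^esub> x" "b \<sqsubseteq>\<^bsub>M\<^esub> y" | "a = \<bottom>\<^bsub>L\<^esub>" | "b = \<bottom>\<^bsub>M\<^esub>" by (auto simp: rect_eq x y)
  then show "p \<in> T"
  proof cases
    case 1
    then show ?thesis unfolding ab using c x y
      by (intro C_idealD(2)[OF T _ _ m]) (auto intro!: L.meet_le M.meet_le)
  qed (use ab c bot_L[OF T] bot_R[OF T] in auto)
qed

lemma (in two_frames) inj_eq_rect: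
  "x \<in> carrier L \<Longrightarrow> inj1 L M x = rect L M x \<top>\<^bsub>M\<^esub>"
  "y \<in> carrier M \<Longrightarrow> inj2 L M y = rect L M \<top>\<^bsub>L\<^esub> y"
  by (auto simp: rect_eq inj1_def inj2_def)

section \<open>Frame maps through quotients and onto images\<close>

context frame_quot
begin

text \<open>The quotient consists of elements of \<open>L\<close>, so the factor map is
  \<open>h\<close> itself. Joins and the top of the quotient are closures of those of
  \<open>L\<close>, and \<open>h\<close> does not see the closure; meets agree with those of
  \<open>L\<close>.\<close>

lemma frame_map_factors:
  assumes N: "frame N" and h: "frame_map L N h" and hE: "\<And>p p'. (p, p') \<in> E \<Longrightarrow> h p = h p'"
  shows "frame_map (quot_frame L E) N h"
  unfolding frame_map_def join_preserving_def
proof (intro conjI ballI allI impI)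
  note inv = quot_universal[OF N h hE]
  show "h \<in> carrier (quot_frame L E) \<rightarrow> carrier N" using sat_sub frame_mapD(1)[OF h] by auto
  show "h (\<Squnion>\<^bsub>quot_frame L E\<^esub>A) = \<Squnion>\<^bsub>N\<^esub>(h ` A)" if A: "A \<subseteq> carrier (quot_frame L E)" for A
  proof -
    have "A \<subseteq> saturated L E" "A \<subseteq> carrier L" using A sat_sub by auto
    then show ?thesis by (simp add: Q_sup inv frame_mapD(4)[OF h])
  qed
  show "h \<top>\<^bsub>quot_frame L E\<^esub> = \<top>\<^bsub>N\<^esub>"
    using frame_mapD(2)[OF quot_frame_map] inv[OF _ top_closed] frame_mapD(2)[OF h] by simp
  show "h (x \<sqinter>\<^bsub>quot_frame L E\<^esub> y) = h x \<sqinter>\<^bsub>N\<^esub> h y"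
    if "x \<in> carrier (quot_frame L E)" "y \<in> carrier (quot_frame L E)" for x y
    using that sat_sub by (subst Q_meet) (auto intro!: frame_mapD(3)[OF h])
qed

end

text \<open>The operations of a lattice are chosen as extremal elements of its carrier, so a smaller
  carrier could change them. Since \<open>f\<close> preserves them, the old values lie in the range
  and stay extremal there, and antisymmetry leaves no other choice.\<close>

lemma frame_map_onto_image:
  assumes L: "frame L" and M: "frame M" and f: "frame_map L M f"
  shows "frame_map L (M\<lparr>carrier := f ` carrier L\<rparr>) f"
proof -
  interpret L: frame L by fact
  interpret M: frame M by fact
  let ?N = "M\<lparr>carrier := f ` carrier L\<rparr>"
  have sub: "f ` carrier L \<subseteq> carrier M" using frame_mapD(1)[OF f] by auto
  interpret N: partial_order ?N
    by unfold_locales (use sub in \<open>auto simp: M.eq_is_equal subset_iff intro: M.le_trans M.le_antisym\<close>)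
  have fc: "f x \<in> carrier M" if "x \<in> carrier L" for x using that sub by auto
  have sup: "f (\<Squnion>\<^bsub>L\<^esub>A) = \<Squnion>\<^bsub>?N\<^esub>(f ` A)" if A: "A \<subseteq> carrier L" for A
  proof -
    have fA: "f ` A \<subseteq> carrier M" using A fc by auto
    have s: "f (\<Squnion>\<^bsub>L\<^esub>A) = \<Squnion>\<^bsub>M\<^esub>(f ` A)" by (rule frame_mapD(4)[OF f A])
    have l: "least ?N (f (\<Squnion>\<^bsub>L\<^esub>A)) (Upper ?N (f ` A))"
      unfolding least_def
    proof (intro conjI ballI)
      show "f (\<Squnion>\<^bsub>L\<^esub>A) \<in> Upper ?N (f ` A)"
        using M.sup_upper[OF fA] A by (auto simp: Upper_def s[symmetric])
      fix y assume "y \<in> Upper ?N (f ` A)"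
      then have "y \<in> carrier M" "\<And>x. x \<in> f ` A \<Longrightarrow> x \<sqsubseteq>\<^bsub>M\<^esub> y" using A fc by (auto simp: Upper_def)
      then show "f (\<Squnion>\<^bsub>L\<^esub>A) \<sqsubseteq>\<^bsub>?N\<^esub> y" using M.sup_least[OF fA] by (simp add: s)
    qed (auto simp: Upper_def)
    show ?thesis unfolding sup_def[of ?N]
      by (rule some_equality[where P = "\<lambda>x. least ?N x (Upper ?N (f ` A))", OF l, symmetric])
        (use l N.least_unique in blast)
  qed
  have meet: "f (x \<sqinter>\<^bsub>L\<^esub> y) = f x \<sqinter>\<^bsub>?N\<^esub> f y" if xy: "x \<in> carrier L" "y \<in> carrier L" for x y
  proof -
    have m: "f (x \<sqinter>\<^bsub>L\<^esub> y) = f x \<sqinter>\<^bsub>M\<^esub> f y" by (rule frame_mapD(3)[OF f xy])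
    have l: "greatest ?N (f (x \<sqinter>\<^bsub>L\<^esub> y)) (Lower ?N {f x, f y})"
      unfolding greatest_def
    proof (intro conjI ballI)
      show "f (x \<sqinter>\<^bsub>L\<^esub> y) \<in> Lower ?N {f x, f y}"
        using M.meet_left[of "f x" "f y"] M.meet_right[of "f x" "f y"] xy fc by (auto simp: Lower_def m[symmetric])
      fix z assume "z \<in> Lower ?N {f x, f y}"
      then have "z \<in> carrier M" "z \<sqsubseteq>\<^bsub>M\<^esub> f x" "z \<sqsubseteq>\<^bsub>M\<^esub> f y" using xy fc by (auto simp: Lower_def)
      then show "z \<sqsubseteq>\<^bsub>?N\<^esub> f (x \<sqinter>\<^bsub>L\<^esub> y)" using M.meet_le[of z "f x" "f y"] xy fc by (simp add: m)
    qed (auto simp: Lower_def)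
    show ?thesis unfolding meet_def[of ?N] inf_def[of ?N]
      by (rule some_equality[where P = "\<lambda>z. greatest ?N z (Lower ?N {f x, f y})", OF l, symmetric])
        (use l N.greatest_unique in blast)
  qed
  have top: "f \<top>\<^bsub>L\<^esub> = \<top>\<^bsub>?N\<^esub>"
  proof -
    have l: "greatest ?N (f \<top>\<^bsub>L\<^esub>) (carrier ?N)"
      using frame_mapD(2)[OF f] fc by (auto simp: greatest_def image_iff intro!: bexI[of _ "\<top>\<^bsub>L\<^esub>"])
    show ?thesis unfolding top_def[of ?N]
      by (rule some_equality[where P = "\<lambda>z. greatest ?N z (carrier ?N)", OF l, symmetric])
        (use l N.greatest_unique in blast)
  qed
  show ?thesis using sup meet top by (auto simp: frame_map_def join_preserving_def)
qed

lemma subloc_le_quotD: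
  assumes Q: "frame_quot L E" and le: "subloc_le L A (quot_frame L E, quot_map L E)" and p: "(p, p') \<in> E"
  shows "snd A p = snd A p'"
proof -
  interpret frame_quot L E by fact
  from le obtain k where "\<And>x. x \<in> carrier L \<Longrightarrow> snd A x = k (quot_map L E x)" by (auto simp: subloc_le_def)
  then show ?thesis using E p by (auto simp: quot_identifies[OF p])
qed

section \<open>The relation \<open>\<sim>\<close> and parallelism\<close>

locale conic = conic_frame X u d for X :: "'a gorder" (structure) and u d
begin

abbreviation "sim \<equiv> conic_sim X u d"
abbreviation "Sat \<equiv> saturated (X \<otimes>\<^sub>F X) sim"
abbreviation "RF \<equiv> quot_frame (X \<otimes>\<^sub>F X) sim"
abbreviation "q \<equiv> quot_map (X \<otimes>\<^sub>F X) sim"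

sublocale XX: two_frames X X ..
sublocale R: frame_quot "X \<otimes>\<^sub>F X" sim
  by unfold_locales (auto simp: conic_sim_def XX.rect_C)
sublocale RR: two_frames RF RF
  by (intro two_frames.intro R.quot_frame_frame)

lemma u_closed [simp]: "x \<in> carrier X \<Longrightarrow> u x \<in> carrier X"
  and d_closed [simp]: "x \<in> carrier X \<Longrightarrow> d x \<in> carrier X"
  using join_preserving_u join_preserving_d by (auto simp: join_preserving_def)

lemmas u_mono = join_preserving_mono[OF join_preserving_u]
lemmas d_mono = join_preserving_mono[OF join_preserving_d]

text \<open>Stated for corners, because a rectangle with a bottom side does not determine its
  corners.\<close>

definition simil :: "'a \<Rightarrow> 'a \<Rightarrow> 'a \<Rightarrow> 'a \<Rightarrow> bool" where
  "simil a b a' b' \<longleftrightarrow> a \<in> carrier X \<and> b \<in> carrier X \<and> a' \<in> carrier X \<and> b' \<in> carrier X \<and>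
     u a \<sqinter> b = u a' \<sqinter> b' \<and> a \<sqinter> d b = a' \<sqinter> d b'"

lemma conic_sim_iff: "(p, p') \<in> sim \<longleftrightarrow> (\<exists>a b a' b'. p = rect X X a b \<and> p' = rect X X a' b' \<and> simil a b a' b')"
  by (auto simp: conic_sim_def simil_def)

text \<open>Parallelism gives \<open>u (a \<sqinter> x) \<sqinter> b \<sqsubseteq> u ((a \<sqinter>
  d b) \<sqinter> x)\<close>, and monotonicity gives
  \<open>u (a \<sqinter> x) \<sqsubseteq> u a\<close>. Hence the value depends on \<open>a\<close>
  and \<open>b\<close> only through \<open>u a \<sqinter> b\<close> and
  \<open>a \<sqinter> d b\<close>, the two quantities that \<open>\<sim>\<close> compares.\<close>

lemma u_meet_restrict:
  assumes "a \<in> carrier X" "b \<in> carrier X" "x \<in> carrier X" "w \<in> carrier X"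
  shows "u (a \<sqinter> x) \<sqinter> (b \<sqinter> w) = u ((a \<sqinter> d b) \<sqinter> x) \<sqinter> ((u a \<sqinter> b) \<sqinter> w)"
proof (rule le_antisym)
  have "u (a \<sqinter> x) \<sqinter> b \<sqsubseteq> u ((a \<sqinter> x) \<sqinter> d b)" using parallel_u assms by simp
  also have "(a \<sqinter> x) \<sqinter> d b = (a \<sqinter> d b) \<sqinter> x" using assms by (metis meet_assoc meet_comm d_closed)
  finally have 1: "u (a \<sqinter> x) \<sqinter> b \<sqsubseteq> u ((a \<sqinter> d b) \<sqinter> x)" .
  have 2: "u (a \<sqinter> x) \<sqsubseteq> u a" using assms by (intro u_mono) (auto simp: meet_left)
  have z: "u (a \<sqinter> x) \<sqinter> (b \<sqinter> w) \<sqsubseteq> u (a \<sqinter> x)" "u (a \<sqinter> x) \<sqinter> (b \<sqinter> w) \<sqsubseteq> b" "u (a \<sqinter> x) \<sqinter> (b \<sqinter> w) \<sqsubseteq> w"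
    using assms le_meet_iff[of "u (a \<sqinter> x) \<sqinter> (b \<sqinter> w)" "u (a \<sqinter> x)" "b \<sqinter> w"] le_meet_iff[of "u (a \<sqinter> x) \<sqinter> (b \<sqinter> w)" b w] by auto
  then have "u (a \<sqinter> x) \<sqinter> (b \<sqinter> w) \<sqsubseteq> u (a \<sqinter> x) \<sqinter> b" using assms by (simp add: le_meet_iff)
  from le_trans[OF this 1] z le_trans[OF z(1) 2]
  show "u (a \<sqinter> x) \<sqinter> (b \<sqinter> w) \<sqsubseteq> u ((a \<sqinter> d b) \<sqinter> x) \<sqinter> ((u a \<sqinter> b) \<sqinter> w)" using assms by (simp add: le_meet_iff)
  have "u ((a \<sqinter> d b) \<sqinter> x) \<sqsubseteq> u (a \<sqinter> x)" using assms by (intro u_mono meet_mono) (auto simp: meet_left)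
  then show "u ((a \<sqinter> d b) \<sqinter> x) \<sqinter> ((u a \<sqinter> b) \<sqinter> w) \<sqsubseteq> u (a \<sqinter> x) \<sqinter> (b \<sqinter> w)"
    using assms by (intro meet_mono) (auto simp: meet_right)
qed (use assms in auto)

text \<open>Exchanging \<open>u\<close> and \<open>d\<close> turns each parallel law into the other,
  so facts about \<open>d\<close> follow from those about \<open>u\<close> with the coordinates
  swapped.\<close>

lemma conic_flip: "conic_frame X d u"
  by unfold_locales (use join_preserving_u join_preserving_d parallel_u parallel_d in \<open>auto simp: meet_comm\<close>)

lemma d_meet_restrict:
  assumes "a \<in> carrier X" "b \<in> carrier X" "x \<in> carrier X" "w \<in> carrier X"
  shows "(a \<sqinter> x) \<sqinter> d (b \<sqinter> w) = ((a \<sqinter> d b) \<sqinter> x) \<sqinter> d ((u a \<sqinter> b) \<sqinter> w)"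
proof -
  interpret D: conic X d u by (rule conic.intro[OF conic_flip])
  show ?thesis using D.u_meet_restrict[OF assms(2,1,4,3)] by (simp add: meet_comm)
qed

text \<open>The free \<open>x\<close> and \<open>w\<close> make the invariance survive a meet with a
  further rectangle, as saturation demands.\<close>

lemma simil_u: "\<lbrakk>simil a b a' b'; x \<in> carrier X; w \<in> carrier X\<rbrakk> \<Longrightarrow> u (a \<sqinter> x) \<sqinter> (b \<sqinter> w) = u (a' \<sqinter> x) \<sqinter> (b' \<sqinter> w)"
  and simil_d: "\<lbrakk>simil a b a' b'; x \<in> carrier X; w \<in> carrier X\<rbrakk> \<Longrightarrow> (a \<sqinter> x) \<sqinter> d (b \<sqinter> w) = (a' \<sqinter> x) \<sqinter> d (b' \<sqinter> w)"
  unfolding simil_def by (metis u_meet_restrict) (metis d_meet_restrict)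

section \<open>Join-preserving maps out of the relation\<close>

text \<open>These are the join-preserving maps from the frame of the relation to that of
  \<open>X\<close>, described by their values on rectangles: they preserve joins in each variable
  and agree on similar pairs, even after a meet with a further pair.\<close>

definition balanced :: "('a \<Rightarrow> 'a \<Rightarrow> 'a) \<Rightarrow> bool" where
  "balanced g \<longleftrightarrow>
     (\<forall>b\<in>carrier X. join_preserving X X (\<lambda>a. g a b)) \<and> (\<forall>a\<in>carrier X. join_preserving X X (g a)) \<and>
     (\<forall>a b a' b'. simil a b a' b' \<longrightarrow>
       (\<forall>x\<in>carrier X. \<forall>w\<in>carrier X. g (a \<sqinter> x) (b \<sqinter> w) = g (a' \<sqinter> x) (b' \<sqinter> w)))"

text \<open>For balanced \<open>g\<close> this is the value at \<open>z\<close> of the right adjoint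
  of the induced join-preserving map. Using it avoids the construction of that map.\<close>

definition below :: "('a \<Rightarrow> 'a \<Rightarrow> 'a) \<Rightarrow> 'a \<Rightarrow> ('a \<times> 'a) set" where
  "below g z = {(a, b) \<in> carrier X \<times> carrier X. g a b \<sqsubseteq> z}"

lemma below_C:
  assumes g: "balanced g" and z: "z \<in> carrier X"
  shows "below g z \<in> C_ideals X X"
proof -
  have j1: "join_preserving X X (\<lambda>a. g a b)" if "b \<in> carrier X" for b using g that by (simp add: balanced_def)
  have j2: "join_preserving X X (g a)" if "a \<in> carrier X" for a using g that by (simp add: balanced_def)
  have c: "g a b \<in> carrier X" if "a \<in> carrier X" "b \<in> carrier X" for a b
    using j1[of b] that by (auto simp: join_preserving_def)
  show ?thesis
  proof (rule C_idealI)
    show "below g z \<subseteq> carrier X \<times> carrier X" by (auto simp: below_def)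
  next
    fix a b a' b' assume h: "a \<in> carrier X" "b \<in> carrier X" "(a', b') \<in> below g z" "a \<sqsubseteq> a'" "b \<sqsubseteq> b'"
    then have c': "a' \<in> carrier X" "b' \<in> carrier X" by (auto simp: below_def)
    have "g a b \<sqsubseteq> g a' b" using join_preserving_mono[OF j1] h c' by simp
    also have "\<dots> \<sqsubseteq> g a' b'" using join_preserving_mono[OF j2] h c' by simp
    also have "\<dots> \<sqsubseteq> z" using h by (simp add: below_def)
    finally show "(a, b) \<in> below g z" using h c c' z by (simp add: below_def)
  next
    fix A b assume h: "A \<subseteq> carrier X" "b \<in> carrier X" "\<And>a. a \<in> A \<Longrightarrow> (a, b) \<in> below g z"
    have "g (\<Squnion>A) b = \<Squnion>((\<lambda>a. g a b) ` A)" using j1[OF h(2)] h(1) by (simp add: join_preserving_def)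
    also have "\<dots> \<sqsubseteq> z" using h z c by (intro sup_least) (auto simp: below_def)
    finally show "(\<Squnion>A, b) \<in> below g z" using h by (simp add: below_def)
  next
    fix a B assume h: "a \<in> carrier X" "B \<subseteq> carrier X" "\<And>b. b \<in> B \<Longrightarrow> (a, b) \<in> below g z"
    have "g a (\<Squnion>B) = \<Squnion>(g a ` B)" using j2[OF h(1)] h(2) by (simp add: join_preserving_def)
    also have "\<dots> \<sqsubseteq> z" using h z c by (intro sup_least) (auto simp: below_def)
    finally show "(a, \<Squnion>B) \<in> below g z" using h by (simp add: below_def)
  qed
qed

text \<open>By \<open>rect_meet_subset_iff\<close> the test against \<open>W\<close> runs over the
  pairs of \<open>W\<close>, and at each of them \<open>g\<close> takes the same value for both
  rectangles.\<close>

lemma below_Sat: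
  assumes g: "balanced g" and z: "z \<in> carrier X"
  shows "below g z \<in> Sat"
proof -
  have "p \<sqinter>\<^bsub>X \<otimes>\<^sub>F X\<^esub> W \<subseteq> below g z \<longleftrightarrow> p' \<sqinter>\<^bsub>X \<otimes>\<^sub>F X\<^esub> W \<subseteq> below g z"
    if p: "(p, p') \<in> sim" and W: "W \<in> C_ideals X X" for p p' W
  proof -
    from p obtain a b a' b' where pp: "p = rect X X a b" "p' = rect X X a' b'" and s: "simil a b a' b'"
      by (auto simp: conic_sim_iff)
    have c: "a \<in> carrier X" "b \<in> carrier X" "a' \<in> carrier X" "b' \<in> carrier X" using s by (auto simp: simil_def)
    have "(a \<sqinter> x, b \<sqinter> w) \<in> below g z \<longleftrightarrow> (a' \<sqinter> x, b' \<sqinter> w) \<in> below g z" if xw: "(x, w) \<in> W" for x w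
    proof -
      have c': "x \<in> carrier X" "w \<in> carrier X" using xw C_idealD(1)[OF W] by auto
      then have "g (a \<sqinter> x) (b \<sqinter> w) = g (a' \<sqinter> x) (b' \<sqinter> w)" using g s unfolding balanced_def by blast
      then show ?thesis using c c' by (simp add: below_def)
    qed
    then show ?thesis unfolding pp
      by (subst (1 2) XX.rect_meet_subset_iff[OF below_C[OF g z] W]) (use c in auto)
  qed
  then show ?thesis using below_C[OF g z] by (auto simp: saturated_def)
qed

text \<open>The constant \<open>c\<close> is absorbed into the \<open>x\<close> that
  \<open>simil_u\<close> leaves free. The choice \<open>c = \<top>\<close> describes a single step;
  other choices carry the fixed data of a path.\<close>

lemma balanced_u: 
  assumes c: "c \<in> carrier X" shows "balanced (\<lambda>a b. u (c \<sqinter> a) \<sqinter> b)"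
  unfolding balanced_def
proof (intro conjI ballI allI impI)
  fix a b a' b' x w assume s: "simil a b a' b'" and x: "x \<in> carrier X" and w: "w \<in> carrier X"
  have "c \<sqinter> (r \<sqinter> x) = r \<sqinter> (c \<sqinter> x)" if "r \<in> carrier X" for r
    using that c x by (metis meet_assoc meet_comm)
  then show "u (c \<sqinter> (a \<sqinter> x)) \<sqinter> (b \<sqinter> w) = u (c \<sqinter> (a' \<sqinter> x)) \<sqinter> (b' \<sqinter> w)"
    using simil_u[OF s, of "c \<sqinter> x" w] s c x w by (simp add: simil_def)
qed (use c in \<open>auto intro!: join_preserving_meet join_preserving_comp[OF _ join_preserving_u] join_preserving_id\<close>)

lemma balanced_d: 
  assumes c: "c \<in> carrier X" shows "balanced (\<lambda>a b. a \<sqinter> d (b \<sqinter> c))"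
  unfolding balanced_def
proof (intro conjI ballI allI impI)
  fix a b a' b' x w assume s: "simil a b a' b'" and x: "x \<in> carrier X" and w: "w \<in> carrier X"
  show "(a \<sqinter> x) \<sqinter> d ((b \<sqinter> w) \<sqinter> c) = (a' \<sqinter> x) \<sqinter> d ((b' \<sqinter> w) \<sqinter> c)"
    using simil_d[OF s, of x "w \<sqinter> c"] s c x w by (simp add: simil_def meet_assoc)
qed (use c in \<open>auto intro!: join_preserving_meet join_preserving_comp[OF _ join_preserving_d] join_preserving_id\<close>)

lemma balanced_comp:
  assumes g: "balanced g" and f: "join_preserving X X f"
  shows "balanced (\<lambda>a b. f (g a b))"
  unfolding balanced_def
proof (intro conjI ballI allI impI)
  fix a b a' b' x w assume "simil a b a' b'" "x \<in> carrier X" "w \<in> carrier X"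
  then show "f (g (a \<sqinter> x) (b \<sqinter> w)) = f (g (a' \<sqinter> x) (b' \<sqinter> w))" using g unfolding balanced_def by metis
qed (use g in \<open>auto simp: balanced_def intro: join_preserving_comp[OF _ f]\<close>)

lemma balanced_cong:
  assumes g: "balanced g" and eq: "\<And>a b. \<lbrakk>a \<in> carrier X; b \<in> carrier X\<rbrakk> \<Longrightarrow> g' a b = g a b"
  shows "balanced g'"
proof -
  have im: "(\<lambda>a. g' a b) ` A = (\<lambda>a. g a b) ` A" "g' b ` A = g b ` A" if "A \<subseteq> carrier X" "b \<in> carrier X" for A b
    using that eq by (auto intro!: image_cong)
  show ?thesis using g by (auto simp: balanced_def join_preserving_def Pi_iff eq im simil_def)
qed

section \<open>Source and target maps\<close>

abbreviation "src \<equiv> source X (conic_rel X u d)"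
abbreviation "tgt \<equiv> target X (conic_rel X u d)"

lemma src_eq: "src x = q (inj1 X X x)" and tgt_eq: "tgt x = q (inj2 X X x)"
  by (simp_all add: source_def target_def conic_rel_def)

lemma src_frame_map: "frame_map X RF src" and tgt_frame_map: "frame_map X RF tgt"
  unfolding source_def target_def conic_rel_def snd_conv
  by (rule frame_map_comp[OF _ R.quot_frame_map], rule XX.inj1_frame_map XX.inj2_frame_map)+

lemma src_Sat [simp]: "x \<in> carrier X \<Longrightarrow> src x \<in> Sat" and tgt_Sat [simp]: "x \<in> carrier X \<Longrightarrow> tgt x \<in> Sat"
  using frame_mapD(1)[OF src_frame_map, of x] frame_mapD(1)[OF tgt_frame_map, of x] by simp_all

lemma Sat_C: "U \<in> Sat \<Longrightarrow> U \<in> C_ideals X X" by (simp add: saturated_def)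

lemma RF_meet: "\<lbrakk>U \<in> Sat; V \<in> Sat\<rbrakk> \<Longrightarrow> U \<sqinter>\<^bsub>RF\<^esub> V = U \<inter> V"
  by (simp add: R.Q_meet XX.coprod_meet Sat_C)

lemma Int_Sat: "\<lbrakk>U \<in> Sat; V \<in> Sat\<rbrakk> \<Longrightarrow> U \<inter> V \<in> Sat"
  using R.Q.meet_closed[of U V] by (simp add: RF_meet)

lemma Sat_memD: "\<lbrakk>S \<in> Sat; (a, b) \<in> S\<rbrakk> \<Longrightarrow> a \<in> carrier X \<and> b \<in> carrier X"
  using C_idealD(1)[OF Sat_C, of S] by auto

lemma q_rect:
  assumes "a \<in> carrier X" "b \<in> carrier X"
  shows "q (rect X X a b) = src a \<sqinter>\<^bsub>RF\<^esub> tgt b"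
  unfolding rect_def src_eq tgt_eq using assms
  by (intro frame_mapD(3)[OF R.quot_frame_map]) (auto simp: XX.inj1_C XX.inj2_C)

text \<open>\<open>src x\<close> is the least saturated set above the rectangle
  \<open>x \<otimes> \<top>\<close>, so its corner decides.\<close>

lemma src_subset_iff: "\<lbrakk>x \<in> carrier X; S \<in> Sat\<rbrakk> \<Longrightarrow> src x \<subseteq> S \<longleftrightarrow> (x, \<top>) \<in> S"
  and tgt_subset_iff: "\<lbrakk>x \<in> carrier X; S \<in> Sat\<rbrakk> \<Longrightarrow> tgt x \<subseteq> S \<longleftrightarrow> (\<top>, x) \<in> S"
  unfolding src_eq tgt_eq using R.quot_le_iff[of _ S]
  by (simp_all add: XX.inj_eq_rect XX.rect_C XX.rect_subset_iff Sat_C)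

lemma src_mem: "\<lbrakk>x \<in> carrier X; y \<in> carrier X\<rbrakk> \<Longrightarrow> (x, y) \<in> src x"
  and tgt_mem: "\<lbrakk>x \<in> carrier X; y \<in> carrier X\<rbrakk> \<Longrightarrow> (y, x) \<in> tgt x"
  unfolding src_eq tgt_eq using R.quot_le[of "inj1 X X x"] R.quot_le[of "inj2 X X x"] XX.inj1_C[of x] XX.inj2_C[of x]
  by (auto simp: inj1_def inj2_def)

text \<open>The set of pairs with \<open>a \<sqinter> d b \<sqsubseteq> x\<close> is saturated and
  contains \<open>(x, \<top>)\<close>, hence contains \<open>src x\<close>. At
  \<open>a = \<top>\<close> this recovers \<open>d\<close> from the relation;
  \<open>tgt_memD\<close> recovers \<open>u\<close> in the same way.\<close>

lemma src_memD: "\<lbrakk>x \<in> carrier X; (a, b) \<in> src x\<rbrakk> \<Longrightarrow> a \<sqinter> d b \<sqsubseteq> x"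
  using src_subset_iff[of x "below (\<lambda>a b. a \<sqinter> d (b \<sqinter> \<top>)) x"] below_Sat[OF balanced_d, of \<top> x] Sat_memD[OF src_Sat, of x a b]
  by (auto simp: below_def meet_left)

lemma tgt_memD: "\<lbrakk>x \<in> carrier X; (a, b) \<in> tgt x\<rbrakk> \<Longrightarrow> u a \<sqinter> b \<sqsubseteq> x"
  using tgt_subset_iff[of x "below (\<lambda>a b. u (\<top> \<sqinter> a) \<sqinter> b) x"] below_Sat[OF balanced_u, of \<top> x] Sat_memD[OF tgt_Sat, of x a b]
  by (auto simp: below_def meet_right)

text \<open>The nontrivial half is parallelism at \<open>\<top>\<close>:
  \<open>a \<sqinter> d \<top> \<sqsubseteq> d (u a)\<close>.\<close>

lemma simil_top_right:
  assumes a: "a \<in> carrier X" shows "simil a \<top> a (u a)"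
proof -
  have "a \<sqinter> d \<top> \<sqsubseteq> d (u a)" using parallel_d[of a \<top>] a by simp
  then have "a \<sqinter> d \<top> \<sqsubseteq> a \<sqinter> d (u a)" using a by (simp add: le_meet_iff meet_left)
  moreover have "a \<sqinter> d (u a) \<sqsubseteq> a \<sqinter> d \<top>" using a by (intro meet_mono d_mono) auto
  ultimately have "a \<sqinter> d \<top> = a \<sqinter> d (u a)" using a by (intro le_antisym) auto
  then show ?thesis using a by (simp add: simil_def) (auto intro!: meet_eqI[symmetric])
qed

lemma simil_flip: "simil a b a' b' \<longleftrightarrow> conic.simil X d u b a b' a'"
proof -
  interpret D: conic X d u by (rule conic.intro[OF conic_flip])
  show ?thesis by (auto simp: simil_def D.simil_def meet_comm)
qed

lemma simil_top_left: "b \<in> carrier X \<Longrightarrow> simil \<top> b (d b) b"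
  using conic.simil_top_right[OF conic.intro[OF conic_flip]] by (simp add: simil_flip)

lemma q_simil: "simil a b a' b' \<Longrightarrow> q (rect X X a b) = q (rect X X a' b')"
  by (rule R.quot_identifies) (auto simp: conic_sim_iff)

lemma src_top: "src \<top> = \<top>\<^bsub>RF\<^esub>" and tgt_top: "tgt \<top> = \<top>\<^bsub>RF\<^esub>"
  using frame_mapD(2)[OF src_frame_map] frame_mapD(2)[OF tgt_frame_map] by simp_all

lemma src_le_tgt: "a \<in> carrier X \<Longrightarrow> src a \<sqsubseteq>\<^bsub>RF\<^esub> tgt (u a)"
  using q_simil[OF simil_top_right, of a] R.Q.meet_right[of "src a" "tgt (u a)"] by (simp add: q_rect tgt_top)

lemma tgt_le_src: "b \<in> carrier X \<Longrightarrow> tgt b \<sqsubseteq>\<^bsub>RF\<^esub> src (d b)"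
  using q_simil[OF simil_top_left, of b] R.Q.meet_left[of "src (d b)" "tgt b"] by (simp add: q_rect src_top)

section \<open>Inclusion in the relation, tested on similar rectangles\<close>

text \<open>The map that witnesses the inclusion is \<open>snd A\<close> itself. The first two
  conclusions expose it, since symmetry and transitivity use it with a further argument on
  top.\<close>

lemma subloc_le_conicI:
  assumes A: "frame (fst A)" "frame_map (X \<otimes>\<^sub>F X) (fst A) (snd A)"
    and resp: "\<And>a b a' b'. simil a b a' b' \<Longrightarrow> snd A (rect X X a b) = snd A (rect X X a' b')"
  shows "frame_map RF (fst A) (snd A)" "\<And>x. x \<in> C_ideals X X \<Longrightarrow> snd A (q x) = snd A x" 
    "subloc_le (X \<otimes>\<^sub>F X) A (conic_rel X u d)"
proof -
  have r: "snd A p = snd A p'" if "(p, p') \<in> sim" for p p'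
    using that resp by (auto simp: conic_sim_iff)
  show 1: "frame_map RF (fst A) (snd A)" by (rule R.frame_map_factors[OF A r])
  show 2: "snd A (q x) = snd A x" if "x \<in> C_ideals X X" for x
    using R.quot_universal[OF A r] that by simp
  show "subloc_le (X \<otimes>\<^sub>F X) A (conic_rel X u d)"
    using 1 2 by (auto simp: subloc_le_def conic_rel_def intro!: exI[of _ "snd A"])
qed

lemma subloc_le_conicD:
  assumes "subloc_le (X \<otimes>\<^sub>F X) A (conic_rel X u d)" "simil a b a' b'"
  shows "snd A (rect X X a b) = snd A (rect X X a' b')"
  by (rule subloc_le_quotD[OF R.frame_quot_axioms assms(1)[unfolded conic_rel_def]])
    (use assms(2) in \<open>auto simp: conic_sim_iff\<close>)

section \<open>Reflexivity\<close>

lemma reflexive_iff: "reflexive_rel X (conic_rel X u d) \<longleftrightarrow> inflationary X u \<and> inflationary X d"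
proof -
  interpret D: cocone X X X id id
    by unfold_locales (auto simp: frame_map_def join_preserving_def)
  show ?thesis
  proof (intro iffI conjI)
    assume refl: "reflexive_rel X (conic_rel X u d)"
    \<comment> \<open>The diagonal sends \<open>a \<otimes> b\<close> to
      \<open>a \<sqinter> b\<close>. Applied to
      \<open>x \<otimes> \<top> \<sim> x \<otimes> u x\<close>, this yields
      \<open>x = x \<sqinter> u x\<close>.\<close>
    have eq: "a \<sqinter> b = a' \<sqinter> b'" if "simil a b a' b'" for a b a' b'
      using subloc_le_conicD[OF refl[unfolded reflexive_rel_def] that] that
      by (simp add: diagonal_def D.copair_rect simil_def)
    show "inflationary X u" unfolding inflationary_def
    proof
      fix x assume x: "x \<in> carrier X"
      then show "x \<sqsubseteq> u x" using eq[OF simil_top_right[OF x]] meet_right[of x "u x"] by simp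
    qed
    show "inflationary X d" unfolding inflationary_def
    proof
      fix x assume x: "x \<in> carrier X"
      then show "x \<sqsubseteq> d x" using eq[OF simil_top_left[OF x]] meet_left[of "d x" x] by simp
    qed
  next
    assume h: "inflationary X u \<and> inflationary X d"
    \<comment> \<open>For inflationary \<open>u\<close> and \<open>d\<close> the meet is a function
      of the two quantities that \<open>\<sim>\<close> compares, so the diagonal respects
      \<open>\<sim>\<close>.\<close>
    have m: "a \<sqinter> b = (u a \<sqinter> b) \<sqinter> (a \<sqinter> d b)" if "a \<in> carrier X" "b \<in> carrier X" for a b
    proof -
      have "a \<sqinter> u a = a" "b \<sqinter> d b = b" using h that by (auto simp: inflationary_def intro!: meet_eqI)
      then show ?thesis using that by (metis meet_assoc meet_comm u_closed d_closed meet_closed)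
    qed
    have "snd (diagonal X) (rect X X a b) = snd (diagonal X) (rect X X a' b')" if s: "simil a b a' b'" for a b a' b'
    proof -
      have "a \<in> carrier X" "b \<in> carrier X" "a' \<in> carrier X" "b' \<in> carrier X" using s by (simp_all add: simil_def)
      then show ?thesis using s m[of a b] m[of a' b'] by (simp add: diagonal_def D.copair_rect simil_def)
    qed
    then show "reflexive_rel X (conic_rel X u d)" unfolding reflexive_rel_def
      by (intro subloc_le_conicI(3)) (auto simp: diagonal_def D.copair_frame_map frame_axioms)
  qed
qed

section \<open>Symmetry\<close>

lemma symmetric_iff: "symmetric_rel X (conic_rel X u d) \<longleftrightarrow> (\<forall>x\<in>carrier X. u x = d x)"
proof -
  interpret T: cocone X X RF tgt src
    by unfold_locales (rule tgt_frame_map src_frame_map)+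
  define op where "op = copair RF tgt src"
  have op_rect: "op (rect X X a b) = q (rect X X b a)" if "a \<in> carrier X" "b \<in> carrier X" for a b
    unfolding op_def using that by (simp add: T.copair_rect q_rect meet_comm)
  have op_rel: "op_rel X (RF, q) = (RF, op)"
    using op_def unfolding op_rel_def conic_rel_def by simp
  show ?thesis
  proof
    assume "symmetric_rel X (conic_rel X u d)"
    then obtain k where k: "bij_betw k Sat Sat" "\<And>x. x \<in> C_ideals X X \<Longrightarrow> q x = k (op x)"
      by (auto simp: symmetric_rel_def subloc_eq_def conic_rel_def op_rel)
    \<comment> \<open>Injectivity of \<open>k\<close> transfers the identifications made by
      \<open>q\<close> to \<open>op\<close>, which swaps the sides of rectangles.\<close>
    have swap: "q (rect X X b a) = q (rect X X b' a')" if s: "simil a b a' b'" for a b a' b'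
    proof -
      have c: "a \<in> carrier X" "b \<in> carrier X" "a' \<in> carrier X" "b' \<in> carrier X" using s by (simp_all add: simil_def)
      have "k (op (rect X X a b)) = k (op (rect X X a' b'))"
        using q_simil[OF s] c by (simp flip: k(2) add: XX.rect_C)
      then show ?thesis
        using inj_onD[OF bij_betw_imp_inj_on[OF k(1)]] R.quot_sat c by (simp add: op_rect XX.rect_C)
    qed
    show "\<forall>x\<in>carrier X. u x = d x"
    proof
      fix x assume x: "x \<in> carrier X"
      \<comment> \<open>The swapped form of \<open>x \<otimes> \<top> \<sim> x \<otimes> u x\<close>
        puts the target preimage of \<open>x\<close> below the source preimage of
        \<open>u x\<close>, which bounds \<open>d x\<close> by \<open>u x\<close>.\<close>
      have "q (rect X X \<top> x) = q (rect X X (u x) x)" using swap[OF simil_top_right[OF x]] .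
      then have "tgt x \<sqsubseteq>\<^bsub>RF\<^esub> src (u x)" 
        using x R.Q.meet_left[of "src (u x)" "tgt x"] by (simp add: q_rect src_top)
      then have "(\<top>, x) \<in> src (u x)" using x tgt_mem[of x \<top>] by auto
      then have 1: "d x \<sqsubseteq> u x" using src_memD[of "u x" \<top> x] x by simp
      have "q (rect X X x \<top>) = q (rect X X x (d x))" using swap[OF simil_top_left[OF x]] .
      then have "src x \<sqsubseteq>\<^bsub>RF\<^esub> tgt (d x)" 
        using x R.Q.meet_right[of "src x" "tgt (d x)"] by (simp add: q_rect tgt_top)
      then have "(x, \<top>) \<in> tgt (d x)" using x src_mem[of x \<top>] by auto
      then have "u x \<sqsubseteq> d x" using tgt_memD[of "d x" x \<top>] x by simp
      then show "u x = d x" using 1 x by (intro le_antisym) auto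
    qed
  next
    assume ud: "\<forall>x\<in>carrier X. u x = d x"
    have resp: "op (rect X X a b) = op (rect X X a' b')" if s: "simil a b a' b'" for a b a' b'
    proof -
      have "simil b a b' a'" using s ud by (auto simp: simil_def meet_comm)
      then show ?thesis using q_simil s by (simp add: op_rect simil_def)
    qed
    have fm: "frame_map (X \<otimes>\<^sub>F X) RF op" unfolding op_def by (rule T.copair_frame_map)
    have op: "frame_map RF RF op" "\<And>U. U \<in> C_ideals X X \<Longrightarrow> op (q U) = op U"
      using subloc_le_conicI(1,2)[of "(RF, op)"] R.quot_frame_frame fm resp by simp_all
    interpret ST: cocone X X RF src tgt
      by unfold_locales (rule tgt_frame_map src_frame_map)+
    have fm2: "frame_map (X \<otimes>\<^sub>F X) RF (op \<circ> op)" by (rule frame_map_comp[OF fm op(1)])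
    \<comment> \<open>Both sides are frame maps out of the coproduct that restrict to
      \<open>src\<close> and \<open>tgt\<close> on the injections, so uniqueness of the copairing
      applies. On saturated elements \<open>q\<close> is the identity, which makes \<open>op\<close>
      its own inverse and the required isomorphism.\<close>
    have opop: "op (op U) = q U" if U: "U \<in> C_ideals X X" for U
    proof -
      have "(op \<circ> op) U = copair RF src tgt U"
      proof (rule ST.copair_unique[OF fm2])
        show "(op \<circ> op) (inj1 X X x) = src x" if "x \<in> carrier X" for x
          using that op(2)[OF XX.inj2_C[OF that]] by (simp add: op_def T.copair_inj1 T.copair_inj2 tgt_eq)
        show "(op \<circ> op) (inj2 X X x) = tgt x" if "x \<in> carrier X" for x
          using that op(2)[OF XX.inj1_C[OF that]] by (simp add: op_def T.copair_inj1 T.copair_inj2 src_eq)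
      qed (use U in simp)
      moreover have "q U = copair RF src tgt U"
        by (rule ST.copair_unique[OF R.quot_frame_map]) (use U in \<open>auto simp: src_eq tgt_eq\<close>)
      ultimately show ?thesis by simp
    qed
    have opS: "op x \<in> Sat" "op (op x) = x" if "x \<in> Sat" for x
      using that frame_mapD(1)[OF op(1), of x] opop[OF Sat_C[OF that]] R.quot_id[OF that] by auto
    then have "bij_betw op Sat Sat" by (intro bij_betw_byWitness[of _ op]) auto
    then show "symmetric_rel X (conic_rel X u d)" 
      unfolding symmetric_rel_def subloc_eq_def conic_rel_def op_rel
      using op(1) opop by (auto intro!: exI[of _ op])
  qed
qed

section \<open>The pullback and the composite relation\<close>

abbreviation "gl \<equiv> glue X (conic_rel X u d)"
abbreviation "PB \<equiv> quot_frame (RF \<otimes>\<^sub>F RF) gl"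
abbreviation "pb \<equiv> quot_map (RF \<otimes>\<^sub>F RF) gl"

lemma glue_eq: "gl = (\<lambda>x. (inj1 RF RF (tgt x), inj2 RF RF (src x))) ` carrier X"
  unfolding glue_def by (simp add: conic_rel_def)

sublocale PB: frame_quot "RF \<otimes>\<^sub>F RF" gl
  by unfold_locales (auto simp: glue_eq RR.inj1_C RR.inj2_C)

text \<open>The frame map of the map from the pullback to the product whose image is the composite
  relation.\<close>

definition comp_map :: "('a \<times> 'a) set \<Rightarrow> (('a \<times> 'a) set \<times> ('a \<times> 'a) set) set" where
  "comp_map = copair PB (pb \<circ> inj1 RF RF \<circ> src) (pb \<circ> inj2 RF RF \<circ> tgt)"

lemma self_comp_eq: "self_comp X (conic_rel X u d) = (PB\<lparr>carrier := comp_map ` C_ideals X X\<rparr>, comp_map)"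
proof -
  have "pullback X (conic_rel X u d) = PB" by (simp add: pullback_def conic_rel_def)
  moreover have "proj1 X (conic_rel X u d) = pb \<circ> inj1 RF RF" "proj2 X (conic_rel X u d) = pb \<circ> inj2 RF RF"
    unfolding proj1_def proj2_def by (simp_all add: conic_rel_def)
  ultimately show ?thesis by (simp add: self_comp_def image_subloc_def comp_map_def)
qed

lemma proj1_frame_map: "frame_map RF PB (pb \<circ> inj1 RF RF)"
  and proj2_frame_map: "frame_map RF PB (pb \<circ> inj2 RF RF)"
  by (rule frame_map_comp[OF _ PB.quot_frame_map], rule RR.inj1_frame_map RR.inj2_frame_map)+

sublocale comp: cocone X X PB "pb \<circ> inj1 RF RF \<circ> src" "pb \<circ> inj2 RF RF \<circ> tgt"
  by (intro cocone.intro cocone_axioms.intro XX.two_frames_axioms PB.quot_frame_frame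
      frame_map_comp[OF src_frame_map proj1_frame_map] frame_map_comp[OF tgt_frame_map proj2_frame_map])

lemma comp_map_rect:
  assumes "a \<in> carrier X" "b \<in> carrier X"
  shows "comp_map (rect X X a b) = pb (rect RF RF (src a) (tgt b))"
  unfolding comp_map_def comp.copair_rect[OF assms] rect_def[of RF]
  using frame_mapD(3)[OF PB.quot_frame_map, of "inj1 RF RF (src a)" "inj2 RF RF (tgt b)"] assms
  by (simp add: RR.inj1_C RR.inj2_C)

text \<open>
  A point of the pullback is a path \<open>x R y R z\<close>. For \<open>(a, b) \<in> U\<close> and \<open>(a', b') \<in> V\<close>, the element
  \<open>b \<sqinter> a'\<close> bounds the location of \<open>y\<close>, which is all that gluing along \<open>y\<close> can see.
\<close>

definition paths_below :: "('a \<Rightarrow> 'a \<Rightarrow> 'a \<Rightarrow> 'a) \<Rightarrow> 'a \<Rightarrow> (('a \<times> 'a) set \<times> ('a \<times> 'a) set) set" where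
  "paths_below h z = {(U, V) \<in> Sat \<times> Sat. \<forall>(a, b)\<in>U. \<forall>(a', b')\<in>V. h a (b \<sqinter> a') b' \<sqsubseteq> z}"

lemma paths_belowI:
  assumes "U \<in> Sat" "V \<in> Sat" "\<And>a b a' b'. \<lbrakk>(a, b) \<in> U; (a', b') \<in> V\<rbrakk> \<Longrightarrow> h a (b \<sqinter> a') b' \<sqsubseteq> z"
  shows "(U, V) \<in> paths_below h z"
  using assms by (auto simp: paths_below_def)

lemma paths_belowD:
  assumes "(U, V) \<in> paths_below h z"
  shows "U \<in> Sat" "V \<in> Sat" "\<lbrakk>(a, b) \<in> U; (a', b') \<in> V\<rbrakk> \<Longrightarrow> h a (b \<sqinter> a') b' \<sqsubseteq> z"
  using assms by (auto simp: paths_below_def)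

text \<open>The two-step counterpart of \<open>below_Sat\<close>: by \<open>left\<close> and
  \<open>right\<close>, \<open>h\<close> is balanced in each step while the other step is
  fixed.\<close>

lemma paths_below_saturated:
  assumes left: "\<And>a m b. \<lbrakk>a \<in> carrier X; m \<in> carrier X; b \<in> carrier X\<rbrakk> \<Longrightarrow> balanced (\<lambda>x y. h (a \<sqinter> x) (y \<sqinter> m) b)"
    and right: "\<And>a m b. \<lbrakk>a \<in> carrier X; m \<in> carrier X; b \<in> carrier X\<rbrakk> \<Longrightarrow> balanced (\<lambda>x y. h a (m \<sqinter> x) (b \<sqinter> y))"
    and z: "z \<in> carrier X"
  shows "paths_below h z \<in> saturated (RF \<otimes>\<^sub>F RF) gl"
proof -
  let ?T = "paths_below h z"
  have TC: "?T \<in> C_ideals RF RF"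
  proof (rule C_idealI)
    show "?T \<subseteq> carrier RF \<times> carrier RF" by (auto simp: paths_below_def)
  next
    fix U V U' V' assume "U \<in> carrier RF" "V \<in> carrier RF" "(U', V') \<in> ?T" "U \<sqsubseteq>\<^bsub>RF\<^esub> U'" "V \<sqsubseteq>\<^bsub>RF\<^esub> V'"
    then show "(U, V) \<in> ?T" by (intro paths_belowI) (auto dest!: paths_belowD(3) simp: subset_iff)
  next
    fix S V assume h: "S \<subseteq> carrier RF" "V \<in> carrier RF" "\<And>U. U \<in> S \<Longrightarrow> (U, V) \<in> ?T"
    show "(\<Squnion>\<^bsub>RF\<^esub>S, V) \<in> ?T"
    proof (rule paths_belowI)
      show S: "\<Squnion>\<^bsub>RF\<^esub>S \<in> Sat" "V \<in> Sat" using R.Q.sup_closed[OF h(1)] h(2) by simp_all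
      fix a b a' b' assume ab: "(a, b) \<in> \<Squnion>\<^bsub>RF\<^esub>S" and ab': "(a', b') \<in> V"
      have c: "a' \<in> carrier X" "b' \<in> carrier X" "a \<in> carrier X" "b \<in> carrier X"
        using Sat_memD[OF S(2) ab'] Sat_memD[OF S(1) ab] by auto
      \<comment> \<open>A join of saturated sets is a closure, so its pairs are not given
        explicitly. The first steps whose value with \<open>(a', b')\<close> is below
        \<open>z\<close> form a saturated set, which therefore contains the join. The
        \<open>\<top>\<close> only gives the function the shape that \<open>left\<close>
        expects.\<close>
      let ?N = "below (\<lambda>x y. h (\<top> \<sqinter> x) (y \<sqinter> a') b') z"
      have "?N \<in> Sat" by (rule below_Sat[OF left z]) (use c in auto)
      moreover have "U \<subseteq> ?N" if "U \<in> S" for U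
        using paths_belowD(1)[OF h(3)[OF that]] paths_belowD(3)[OF h(3)[OF that] _ ab']
        by (auto simp: below_def dest: Sat_memD)
      ultimately have "\<Squnion>\<^bsub>RF\<^esub>S \<subseteq> ?N" using R.Q.sup_least[OF h(1), of ?N] by simp
      then show "h a (b \<sqinter> a') b' \<sqsubseteq> z" using ab c by (auto simp: below_def)
    qed
  next
    fix U S assume h: "U \<in> carrier RF" "S \<subseteq> carrier RF" "\<And>V. V \<in> S \<Longrightarrow> (U, V) \<in> ?T"
    show "(U, \<Squnion>\<^bsub>RF\<^esub>S) \<in> ?T"
    proof (rule paths_belowI)
      show S: "U \<in> Sat" "\<Squnion>\<^bsub>RF\<^esub>S \<in> Sat" using R.Q.sup_closed[OF h(2)] h(1) by simp_all
      fix a b a' b' assume ab: "(a, b) \<in> U" and ab': "(a', b') \<in> \<Squnion>\<^bsub>RF\<^esub>S"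
      have c: "a' \<in> carrier X" "b' \<in> carrier X" "a \<in> carrier X" "b \<in> carrier X"
        using Sat_memD[OF S(2) ab'] Sat_memD[OF S(1) ab] by auto
      let ?N = "below (\<lambda>x y. h a (b \<sqinter> x) (\<top> \<sqinter> y)) z"
      have "?N \<in> Sat" by (rule below_Sat[OF right z]) (use c in auto)
      moreover have "V \<subseteq> ?N" if "V \<in> S" for V
        using paths_belowD(2)[OF h(3)[OF that]] paths_belowD(3)[OF h(3)[OF that] ab]
        by (auto simp: below_def dest: Sat_memD)
      ultimately have "\<Squnion>\<^bsub>RF\<^esub>S \<subseteq> ?N" using R.Q.sup_least[OF h(2), of ?N] by simp
      then show "h a (b \<sqinter> a') b' \<sqsubseteq> z" using ab' c by (auto simp: below_def)
    qed
  qed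
  \<comment> \<open>Cutting the middle point down to \<open>x\<close> through the first step or
    through the second gives the same meet of \<open>b\<close>, \<open>x\<close> and
    \<open>a'\<close>.\<close>
  have glued: "(tgt x \<inter> U, V) \<in> ?T \<longleftrightarrow> (U, src x \<inter> V) \<in> ?T"
    if x: "x \<in> carrier X" and U: "U \<in> Sat" and V: "V \<in> Sat" for x U V
  proof
    assume T: "(tgt x \<inter> U, V) \<in> ?T"
    show "(U, src x \<inter> V) \<in> ?T"
    proof (rule paths_belowI)
      fix a b a' b' assume ab: "(a, b) \<in> U" and ab': "(a', b') \<in> src x \<inter> V"
      have c: "a' \<in> carrier X" "b' \<in> carrier X" "a \<in> carrier X" "b \<in> carrier X"
        using Sat_memD[OF V, of a' b'] ab' Sat_memD[OF U ab] by auto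
      \<comment> \<open>The assumption at \<open>(a, b \<sqinter> x)\<close> says that this
        saturated set contains \<open>(x, \<top>)\<close>, hence all of \<open>src x\<close>.
        Evaluation at \<open>(a', b')\<close> then collapses the repeated meets with
        \<open>a'\<close> and \<open>b'\<close>.\<close>
      let ?N = "below (\<lambda>\<alpha> \<beta>. h a ((b \<sqinter> a') \<sqinter> \<alpha>) (b' \<sqinter> \<beta>)) z"
      have N: "?N \<in> Sat" by (rule below_Sat[OF right z]) (use c in auto)
      have "(a, b \<sqinter> x) \<in> tgt x" 
        using c x by (intro C_idealD(2)[OF Sat_C[OF tgt_Sat[OF x]] _ _ tgt_mem[OF x, of a]]) (auto simp: meet_right)
      moreover have "(a, b \<sqinter> x) \<in> U" 
        using c x by (intro C_idealD(2)[OF Sat_C[OF U] _ _ ab]) (auto simp: meet_left)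
      ultimately have "h a ((b \<sqinter> x) \<sqinter> a') b' \<sqsubseteq> z" using paths_belowD(3)[OF T, of a "b \<sqinter> x" a' b'] ab' by simp
      also have "(b \<sqinter> x) \<sqinter> a' = (b \<sqinter> a') \<sqinter> x" using c x by (metis meet_assoc meet_comm)
      finally have "(x, \<top>) \<in> ?N" using c x by (simp add: below_def)
      then have "(a', b') \<in> ?N" using src_subset_iff[OF x N] ab' by auto
      moreover have "(b \<sqinter> a') \<sqinter> a' = b \<sqinter> a'" "b' \<sqinter> b' = b'" using c by (auto intro!: meet_eqI simp: meet_right)
      ultimately show "h a (b \<sqinter> a') b' \<sqsubseteq> z" by (simp add: below_def)
    qed (use U V x Int_Sat in auto)
  next
    assume T: "(U, src x \<inter> V) \<in> ?T"
    show "(tgt x \<inter> U, V) \<in> ?T"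
    proof (rule paths_belowI)
      fix a b a' b' assume ab: "(a, b) \<in> tgt x \<inter> U" and ab': "(a', b') \<in> V"
      have c: "a' \<in> carrier X" "b' \<in> carrier X" "a \<in> carrier X" "b \<in> carrier X"
        using Sat_memD[OF V ab'] Sat_memD[OF U, of a b] ab by auto
      let ?N = "below (\<lambda>\<alpha> \<beta>. h (a \<sqinter> \<alpha>) (\<beta> \<sqinter> (b \<sqinter> a')) b') z"
      have N: "?N \<in> Sat" by (rule below_Sat[OF left z]) (use c in auto)
      have "(x \<sqinter> a', b') \<in> src x" 
        using c x by (intro C_idealD(2)[OF Sat_C[OF src_Sat[OF x]] _ _ src_mem[OF x, of b']]) (auto simp: meet_left)
      moreover have "(x \<sqinter> a', b') \<in> V" 
        using c x by (intro C_idealD(2)[OF Sat_C[OF V] _ _ ab']) (auto simp: meet_right)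
      ultimately have "h a (b \<sqinter> (x \<sqinter> a')) b' \<sqsubseteq> z" using paths_belowD(3)[OF T, of a b "x \<sqinter> a'" b'] ab by simp
      also have "b \<sqinter> (x \<sqinter> a') = x \<sqinter> (b \<sqinter> a')" using c x by (metis meet_assoc meet_comm)
      finally have "(\<top>, x) \<in> ?N" using c x by (simp add: below_def)
      then have "(a, b) \<in> ?N" using tgt_subset_iff[OF x N] ab by auto
      moreover have "b \<sqinter> (b \<sqinter> a') = b \<sqinter> a'" "a \<sqinter> a = a" using c by (auto intro!: meet_eqI simp: meet_left)
      ultimately show "h a (b \<sqinter> a') b' \<sqsubseteq> z" by (simp add: below_def)
    qed (use U V x Int_Sat in auto)
  qed
  have "inj1 RF RF (tgt x) \<sqinter>\<^bsub>RF \<otimes>\<^sub>F RF\<^esub> W \<subseteq> ?T \<longleftrightarrow> inj2 RF RF (src x) \<sqinter>\<^bsub>RF \<otimes>\<^sub>F RF\<^esub> W \<subseteq> ?T"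
    if x: "x \<in> carrier X" and W: "W \<in> C_ideals RF RF" for x W
  proof -
    have t: "\<top>\<^bsub>RF\<^esub> \<in> Sat" using R.Q.top_closed by simp
    have rt: "\<top>\<^bsub>RF\<^esub> \<sqinter>\<^bsub>RF\<^esub> U = U" if "U \<in> Sat" for U
      using frame.top_meet_eq(1)[OF R.quot_frame_frame, of U] that by simp
    have "(tgt x \<sqinter>\<^bsub>RF\<^esub> U, \<top>\<^bsub>RF\<^esub> \<sqinter>\<^bsub>RF\<^esub> V) \<in> ?T \<longleftrightarrow> (\<top>\<^bsub>RF\<^esub> \<sqinter>\<^bsub>RF\<^esub> U, src x \<sqinter>\<^bsub>RF\<^esub> V) \<in> ?T" if "(U, V) \<in> W" for U V
    proof -
      have "U \<in> Sat" "V \<in> Sat" using that C_idealD(1)[OF W] by auto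
      then show ?thesis using glued x by (simp add: rt RF_meet)
    qed
    then show ?thesis using x t
      by (simp add: RR.inj_eq_rect) (subst (1 2) RR.rect_meet_subset_iff[OF TC W]; auto)
  qed
  then show ?thesis using TC by (auto simp: saturated_def glue_eq)
qed

section \<open>Transitivity implies subidempotence\<close>

text \<open>Transitivity makes \<open>comp_map\<close> identify similar rectangles. It sends
  \<open>a \<otimes> b\<close> to the closure of the rectangle on \<open>src a\<close> and
  \<open>tgt b\<close>, and a saturated \<open>T\<close> contains that closure exactly when it
  contains the corner.\<close>

lemma transitive_paths:
  assumes trans: "transitive_rel X (conic_rel X u d)"
    and T: "T \<in> saturated (RF \<otimes>\<^sub>F RF) gl" and s: "simil a b a' b'"
  shows "(src a, tgt b) \<in> T \<longleftrightarrow> (src a', tgt b') \<in> T"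
proof -
  have c: "a \<in> carrier X" "b \<in> carrier X" "a' \<in> carrier X" "b' \<in> carrier X" using s by (simp_all add: simil_def)
  have "comp_map (rect X X a b) = comp_map (rect X X a' b')"
    using subloc_le_conicD[OF trans[unfolded transitive_rel_def] s] by (simp add: self_comp_eq)
  then have "pb (rect RF RF (src a) (tgt b)) \<subseteq> T \<longleftrightarrow> pb (rect RF RF (src a') (tgt b')) \<subseteq> T"
    using c by (simp add: comp_map_rect)
  moreover have "pb (rect RF RF (src x) (tgt y)) \<subseteq> T \<longleftrightarrow> (src x, tgt y) \<in> T" if "x \<in> carrier X" "y \<in> carrier X" for x y
  proof -
    have "T \<in> C_ideals RF RF" using PB.sat_sub T by auto
    then show ?thesis
      using PB.quot_le_iff[OF _ T, of "rect RF RF (src x) (tgt y)"] that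
      by (simp add: RR.rect_C RR.rect_subset_iff)
  qed
  ultimately show ?thesis using c by simp
qed

text \<open>Paths that end in \<open>u x\<close> satisfy the bound \<open>u x\<close> because of
  their second step. Transitivity with \<open>x \<otimes> u x \<sim> x \<otimes> \<top>\<close>
  extends the bound to all paths that start in \<open>x\<close>, and the largest such path has the
  value \<open>u (u x)\<close>.\<close>

lemma transitive_u:
  assumes trans: "transitive_rel X (conic_rel X u d)" shows "subidempotent X u"
  unfolding subidempotent_def
proof
  fix x assume x: "x \<in> carrier X"
  let ?h = "\<lambda>a m b. u (u a \<sqinter> m) \<sqinter> b"
  have T: "paths_below ?h (u x) \<in> saturated (RF \<otimes>\<^sub>F RF) gl"
  proof (rule paths_below_saturated)
    fix a m b assume c: "a \<in> carrier X" "m \<in> carrier X" "b \<in> carrier X"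
    have f: "join_preserving X X (\<lambda>v. u (v \<sqinter> m) \<sqinter> b)"
      using c by (intro join_preserving_meet join_preserving_comp[OF _ join_preserving_u] join_preserving_id)
    have e: "u (a \<sqinter> v) \<sqinter> (w \<sqinter> m) = (u (a \<sqinter> v) \<sqinter> w) \<sqinter> m" if "v \<in> carrier X" "w \<in> carrier X" for v w
      using c that by (simp add: meet_assoc)
    show "balanced (\<lambda>v w. ?h (a \<sqinter> v) (w \<sqinter> m) b)"
      by (rule balanced_cong[OF balanced_comp[OF balanced_u[OF c(1)] f]]) (use e in simp)
    have f': "join_preserving X X (\<lambda>v. b \<sqinter> v)"
      using c by (intro join_preserving_meet join_preserving_id)
    show "balanced (\<lambda>v w. ?h a (m \<sqinter> v) (b \<sqinter> w))"
      by (rule balanced_cong[OF balanced_comp[OF balanced_u[of "u a \<sqinter> m"] f']])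
        (use c in \<open>auto, metis (no_types, lifting) meet_assoc meet_comm meet_closed u_closed\<close>)
  qed (use x in simp)
  have "(src x, tgt (u x)) \<in> paths_below ?h (u x)"
  proof (rule paths_belowI)
    fix a b a' b' assume ab: "(a, b) \<in> src x" and ab': "(a', b') \<in> tgt (u x)"
    have c: "a \<in> carrier X" "b \<in> carrier X" "a' \<in> carrier X" "b' \<in> carrier X"
      using Sat_memD[OF src_Sat ab] Sat_memD[OF tgt_Sat ab'] x by auto
    have "u (u a \<sqinter> (b \<sqinter> a')) \<sqinter> b' \<sqsubseteq> u a' \<sqinter> b'"
      using c by (intro meet_mono u_mono) (auto simp flip: meet_assoc simp: meet_right)
    also have "\<dots> \<sqsubseteq> u x" using tgt_memD[OF _ ab'] x by simp
    finally show "u (u a \<sqinter> (b \<sqinter> a')) \<sqinter> b' \<sqsubseteq> u x" using c x by simp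
  qed (use x in auto)
  then have "(src x, tgt \<top>) \<in> paths_below ?h (u x)"
    using transitive_paths[OF trans T simil_top_right[OF x]] by simp
  from paths_belowD(3)[OF this src_mem[OF x top_closed] tgt_mem[OF top_closed top_closed]]
  show "u (u x) \<sqsubseteq> u x" using x by simp
qed

text \<open>The mirror image: the bound \<open>d x\<close> comes from the first step of a path that
  starts in \<open>d x\<close>, and \<open>d x \<otimes> x \<sim> \<top> \<otimes> x\<close> extends
  it to all paths that end in \<open>x\<close>.\<close>

lemma transitive_d:
  assumes trans: "transitive_rel X (conic_rel X u d)" shows "subidempotent X d"
  unfolding subidempotent_def
proof
  fix x assume x: "x \<in> carrier X"
  let ?h = "\<lambda>a m b. a \<sqinter> d (m \<sqinter> d b)"
  have T: "paths_below ?h (d x) \<in> saturated (RF \<otimes>\<^sub>F RF) gl"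
  proof (rule paths_below_saturated)
    fix a m b assume c: "a \<in> carrier X" "m \<in> carrier X" "b \<in> carrier X"
    have f: "join_preserving X X (\<lambda>v. a \<sqinter> d (m \<sqinter> v))"
      using c by (intro join_preserving_meet join_preserving_comp[OF _ join_preserving_d] join_preserving_id)
    have e: "(m \<sqinter> v) \<sqinter> d (b \<sqinter> w) = m \<sqinter> (v \<sqinter> d (w \<sqinter> b))" if "v \<in> carrier X" "w \<in> carrier X" for v w
      using c that by (simp add: meet_assoc meet_comm[of _ b])
    show "balanced (\<lambda>v w. ?h a (m \<sqinter> v) (b \<sqinter> w))"
      by (rule balanced_cong[OF balanced_comp[OF balanced_d[OF c(3)] f]]) (use e in simp)
    have f': "join_preserving X X (\<lambda>v. a \<sqinter> v)"
      using c by (intro join_preserving_meet join_preserving_id)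
    show "balanced (\<lambda>v w. ?h (a \<sqinter> v) (w \<sqinter> m) b)"
      by (rule balanced_cong[OF balanced_comp[OF balanced_d[of "m \<sqinter> d b"] f']])
        (use c in \<open>simp_all add: meet_assoc\<close>)
  qed (use x in simp)
  have "(src (d x), tgt x) \<in> paths_below ?h (d x)"
  proof (rule paths_belowI)
    fix a b a' b' assume ab: "(a, b) \<in> src (d x)" and ab': "(a', b') \<in> tgt x"
    have c: "a \<in> carrier X" "b \<in> carrier X" "a' \<in> carrier X" "b' \<in> carrier X"
      using Sat_memD[OF src_Sat ab] Sat_memD[OF tgt_Sat ab'] x by auto
    have "a \<sqinter> d ((b \<sqinter> a') \<sqinter> d b') \<sqsubseteq> a \<sqinter> d b"
      using c by (intro meet_mono d_mono) (auto simp: meet_assoc meet_left)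
    also have "\<dots> \<sqsubseteq> d x" using src_memD[OF _ ab] x by simp
    finally show "a \<sqinter> d ((b \<sqinter> a') \<sqinter> d b') \<sqsubseteq> d x" using c x by simp
  qed (use x in auto)
  then have "(src \<top>, tgt x) \<in> paths_below ?h (d x)"
    using transitive_paths[OF trans T simil_top_left[OF x]] by simp
  from paths_belowD(3)[OF this src_mem[OF top_closed top_closed] tgt_mem[OF x top_closed]]
  show "d (d x) \<sqsubseteq> d x" using x by simp
qed

section \<open>Subidempotence implies transitivity\<close>

text \<open>Two steps move an open set by \<open>u\<close> twice forwards or by \<open>d\<close>
  twice backwards; subidempotence reduces this to once. The ends of a path then obey the
  inequalities of a single step, and these suffice for \<open>comp_map\<close> to respect
  \<open>\<sim>\<close>.\<close>

lemma subidempotent_transitive: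
  assumes su: "subidempotent X u" and sd: "subidempotent X d"
  shows "transitive_rel X (conic_rel X u d)"
proof -
  \<comment> \<open>\<open>f\<close>, \<open>m\<close> and \<open>g\<close> are the preimage maps of
    the start, the middle and the end of a path.\<close>
  define f where "f = pb \<circ> inj1 RF RF \<circ> src"
  define m where "m = pb \<circ> inj2 RF RF \<circ> src"
  define g where "g = pb \<circ> inj2 RF RF \<circ> tgt"
  \<comment> \<open>The gluing: the middle is the target of the first step as well as the source of
    the second.\<close>
  have m': "m x = pb (inj1 RF RF (tgt x))" if "x \<in> carrier X" for x
    using PB.quot_identifies[of "inj1 RF RF (tgt x)" "inj2 RF RF (src x)"] that by (simp add: m_def glue_eq)
  have fm: "frame_map X PB f" "frame_map X PB m" "frame_map X PB g" unfolding f_def m_def g_def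
    by (intro frame_map_comp[OF _ proj1_frame_map] frame_map_comp[OF _ proj2_frame_map] src_frame_map tgt_frame_map)+
  note mono1 = frame_map_mono[OF R.quot_frame_frame PB.quot_frame_frame proj1_frame_map, simplified]
  note mono2 = frame_map_mono[OF R.quot_frame_frame PB.quot_frame_frame proj2_frame_map, simplified]
  have c: "f x \<in> carrier PB" "m x \<in> carrier PB" "g x \<in> carrier PB" if "x \<in> carrier X" for x
    using that frame_mapD(1)[OF fm(1)] frame_mapD(1)[OF fm(2)] frame_mapD(1)[OF fm(3)] by auto
  have fg: "f x \<sqsubseteq>\<^bsub>PB\<^esub> g (u x)" if x: "x \<in> carrier X" for x
  proof -
    have "f x \<sqsubseteq>\<^bsub>PB\<^esub> m (u x)" using src_le_tgt[OF x] x mono1[of "src x" "tgt (u x)"] by (simp add: f_def m')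
    moreover have "m (u x) \<sqsubseteq>\<^bsub>PB\<^esub> g (u (u x))"
      using src_le_tgt[of "u x"] x mono2[of "src (u x)" "tgt (u (u x))"] by (simp add: m_def g_def)
    moreover have "g (u (u x)) \<sqsubseteq>\<^bsub>PB\<^esub> g (u x)"
      by (rule frame_map_mono[OF frame_axioms PB.quot_frame_frame fm(3)]) (use su x in \<open>auto simp: subidempotent_def\<close>)
    ultimately show ?thesis using PB.Q.le_trans c x u_closed by meson
  qed
  have gf: "g x \<sqsubseteq>\<^bsub>PB\<^esub> f (d x)" if x: "x \<in> carrier X" for x
  proof -
    have "g x \<sqsubseteq>\<^bsub>PB\<^esub> m (d x)" using tgt_le_src[OF x] x mono2[of "tgt x" "src (d x)"] by (simp add: g_def m_def)
    moreover have "m (d x) \<sqsubseteq>\<^bsub>PB\<^esub> f (d (d x))"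
      using tgt_le_src[of "d x"] x mono1[of "tgt (d x)" "src (d (d x))"] by (simp add: m' f_def)
    moreover have "f (d (d x)) \<sqsubseteq>\<^bsub>PB\<^esub> f (d x)"
      by (rule frame_map_mono[OF frame_axioms PB.quot_frame_frame fm(1)]) (use sd x in \<open>auto simp: subidempotent_def\<close>)
    ultimately show ?thesis using PB.Q.le_trans c x d_closed by meson
  qed
  have comp_rect: "comp_map (rect X X a b) = f (a \<sqinter> d b) \<sqinter>\<^bsub>PB\<^esub> g (u a \<sqinter> b)" if ab: "a \<in> carrier X" "b \<in> carrier X" for a b
  proof -
    have "comp_map (rect X X a b) = f a \<sqinter>\<^bsub>PB\<^esub> g b"
      using comp.copair_rect[OF ab] by (simp add: comp_map_def f_def g_def)
    \<comment> \<open>The inequalities \<open>fg\<close> and \<open>gf\<close> allow the two extra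
      factors, after which regrouping leaves only the quantities that \<open>\<sim>\<close>
      compares.\<close>
    also have "\<dots> = (f a \<sqinter>\<^bsub>PB\<^esub> g (u a)) \<sqinter>\<^bsub>PB\<^esub> (f (d b) \<sqinter>\<^bsub>PB\<^esub> g b)"
    proof -
      have "f a \<sqinter>\<^bsub>PB\<^esub> g (u a) = f a" using fg[of a] ab c by (intro comp.N.meet_eqI) auto
      moreover have "f (d b) \<sqinter>\<^bsub>PB\<^esub> g b = g b" using gf[of b] ab c by (intro comp.N.meet_eqI) auto
      ultimately show ?thesis by simp
    qed
    also have "\<dots> = (f a \<sqinter>\<^bsub>PB\<^esub> f (d b)) \<sqinter>\<^bsub>PB\<^esub> (g (u a) \<sqinter>\<^bsub>PB\<^esub> g b)"
      using c[OF ab(1)] c[OF ab(2)] c[OF u_closed[OF ab(1)]] c[OF d_closed[OF ab(2)]]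
      by (metis PB.Q.meet_assoc PB.Q.meet_closed meet_comm)
    also have "\<dots> = f (a \<sqinter> d b) \<sqinter>\<^bsub>PB\<^esub> g (u a \<sqinter> b)"
      using ab by (simp add: frame_mapD(3)[OF fm(1)] frame_mapD(3)[OF fm(3)])
    finally show ?thesis .
  qed
  have resp: "comp_map (rect X X a b) = comp_map (rect X X a' b')" if "simil a b a' b'" for a b a' b'
    using that by (simp add: simil_def comp_rect)
  have cm: "frame_map (X \<otimes>\<^sub>F X) PB comp_map" unfolding comp_map_def by (rule comp.copair_frame_map)
  have fac: "frame_map RF PB comp_map" "\<And>U. U \<in> C_ideals X X \<Longrightarrow> comp_map (q U) = comp_map U"
    using subloc_le_conicI(1,2)[of "(PB, comp_map)"] PB.quot_frame_frame cm resp by simp_all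
  \<comment> \<open>The factor map so far lands in the whole pullback. Its range on saturated
    elements is the full range of \<open>comp_map\<close>, so it corestricts to the image that
    defines the composite.\<close>
  have "comp_map ` Sat = comp_map ` C_ideals X X"
  proof
    show "comp_map ` C_ideals X X \<subseteq> comp_map ` Sat"
      using fac(2) R.quot_sat by (metis carrier_coprod image_eqI image_subsetI)
  qed (auto simp: Sat_C)
  then have "frame_map RF (PB\<lparr>carrier := comp_map ` C_ideals X X\<rparr>) comp_map"
    using frame_map_onto_image[OF R.quot_frame_frame PB.quot_frame_frame fac(1)] by simp
  then show ?thesis unfolding transitive_rel_def self_comp_eq subloc_le_def
    using fac(2) by (auto simp: conic_rel_def intro!: exI[of _ comp_map])
qed

end

theorem proposition10p11:
  fixes X :: "'a gorder" and u d :: "'a \<Rightarrow> 'a"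
  assumes "conic_frame X u d"
  shows "(reflexive_rel X (conic_rel X u d) \<longleftrightarrow> inflationary X u \<and> inflationary X d) \<and>
         (transitive_rel X (conic_rel X u d) \<longleftrightarrow> subidempotent X u \<and> subidempotent X d) \<and>
         (symmetric_rel X (conic_rel X u d) \<longleftrightarrow> (\<forall>x\<in>carrier X. u x = d x))"
proof -
  interpret conic X u d by (rule conic.intro[OF assms])
  show ?thesis
    using reflexive_iff symmetric_iff transitive_u transitive_d subidempotent_transitive by blast
qed

end
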